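(* Let $\{\theta_i(t)\}_{i=1}^N$ be a global classical solution of the time-delayed Kuramoto system $$\dot\theta_i(t)=\Omega_i+\frac{\kappa}{N-1}\sum_{j\neq i}\chi_{ij}\sin(\theta_j(t-\tau_{ij})-\theta_i(t)),\quad i=1,\dots,N,\ t>0,$$ with initial data $\theta_i=\theta_i^0$ on $[-\tau,0]$, on a strongly connected digraph $\mathcal G$. Assume $D_\theta(0)<\pi$. Let $\zeta,\xi,d_\infty,\eta$ be real numbers such that $D_\theta(0)<\zeta<\xi<\pi$, $$0<d_\infty<\min\left\{\frac{\pi}{2},d_\theta(0)\right\},\qquad \eta>\max\left\{\frac{1}{\sin\xi},\frac{1}{\cos(R_\omega\tau)},\frac{2}{1-\frac{\zeta}{\xi}}\right\},$$ and put $$\beta:=1-\frac{2}{\eta},\qquad c:=\frac{\left(\sum_{j=1}^{N-1}\eta^jP(2N,j)+1\right)\xi}{\sin\xi}.$$ Assume that $$\tan(R_\omega\tau)<\frac{\beta d_\infty}{\left(1+\frac{\zeta}{\zeta-D_\theta(0)}\right)2(N-1)c},\qquad d_\infty+R_\omega\tau<\frac{\pi}{2},$$ $$\kappa>\left(1+\frac{\zeta}{\zeta-D_\theta(0)}\right)\frac{\left(D(\Omega)+2\kappa\sin(R_\omega\tau)\right)(N-1)c}{2\cos(R_\omega\tau)}\,\frac{1}{\beta d_\infty}.$$ Then the oscillators achieve asymptotic complete frequency synchronization, i.e. $\lim_{t\to\infty}d_\omega(t)=0$.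
   Context: $N\ge 2$ is an integer. $\mathcal G=(\mathcal V,\mathcal E)$ is a digraph with $\mathcal V=\{1,\dots,N\}$, $\mathcal E\subset\mathcal V\times\mathcal V$, without self-loops; $\mathcal N_i=\{j:(i,j)\in\mathcal E\}$ is the set of vertices that directly influence $i$, and $\chi_{ij}=1$ if $j\in\mathcal N_i$ ($j$ transmits information to $i$), $\chi_{ij}=0$ otherwise. $\mathcal G$ is strongly connected if from every vertex there is a directed path to every other vertex. $\Omega_i\in\mathbb R$ are the natural frequencies, $\kappa>0$ is the coupling strength, $\tau_{ij}>0$ for $i\ne j$ are time delays, $\tau_{ii}=0$, $\tau:=\max_{i,j}\tau_{ij}$. The initial data satisfy $\theta_i^0\in C^1_b(-\tau,0)\cap C[-\tau,0]$. Notation: $\omega_i(t):=\dot\theta_i(t)$, with $\omega_i(0):=\lim_{t\to0-}\dot\theta_i(t)$; $d_\theta(t):=\max_{i,j}|\theta_i(t)-\theta_j(t)|$; $d_\omega(t):=\max_{i,j}|\omega_i(t)-\omega_j(t)|$; $D(\Omega):=\max_{i,j}|\Omega_i-\Omega_j|$; $D_\theta(0):=\max_{i,j}\max_{s,t\in[-\tau,0]}|\theta_i(s)-\theta_j(t)|$; $R_\omega:=\max_{1\le i\le N}|\Omega_i|+\kappa$; $P(m,k):=\frac{m!}{(m-k)!}$. *)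

theory Defs
  imports "HOL-Analysis.Analysis" "Graph_Theory.Graph_Theory"
begin

text \<open>
  Vertices and oscillators are the natural numbers in \<open>{1..N}\<close>; functions of an index are total on
  \<open>nat\<close>, and only their values on \<open>{1..N}\<close> are ever used.

  An arc \<open>(i, j)\<close> means that \<open>j\<close> influences \<open>i\<close>, i.e. information flows from the second component
  to the first.
\<close>

definition neighbours :: "nat pair_pre_digraph \<Rightarrow> nat \<Rightarrow> nat set" where
  "neighbours G i = {j. (i, j) \<in> parcs G}"

definition chi :: "nat pair_pre_digraph \<Rightarrow> nat \<Rightarrow> nat \<Rightarrow> real" where
  "chi G i j = (if j \<in> neighbours G i then 1 else 0)"

definition max_delay :: "nat \<Rightarrow> (nat \<Rightarrow> nat \<Rightarrow> real) \<Rightarrow> real" where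
  "max_delay N \<tau> = (MAX (i, j)\<in>{1..N} \<times> {1..N}. \<tau> i j)"

text \<open>\<open>C\<^sup>1\<close> functions on the open interval \<open>(a, b)\<close> that are bounded together with their derivative.\<close>

definition C1_bounded :: "real \<Rightarrow> real \<Rightarrow> (real \<Rightarrow> real) \<Rightarrow> bool" where
  "C1_bounded a b f \<longleftrightarrow>
     (\<forall>t\<in>{a<..<b}. f differentiable (at t)) \<and> continuous_on {a<..<b} (deriv f) \<and>
     bounded (f ` {a<..<b}) \<and> bounded (deriv f ` {a<..<b})"

text \<open>
  A global classical solution. Continuity of \<open>\<theta> i\<close> on \<open>[-max_delay, \<infinity>)\<close> makes the right-hand side
  of the equation continuous in \<open>t\<close>, so \<open>\<theta> i\<close> is automatically \<open>C\<^sup>1\<close> on \<open>(0, \<infinity>)\<close>.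
\<close>

definition kuramoto_solution ::
  "nat \<Rightarrow> nat pair_pre_digraph \<Rightarrow> (nat \<Rightarrow> real) \<Rightarrow> real \<Rightarrow> (nat \<Rightarrow> nat \<Rightarrow> real) \<Rightarrow>
   (nat \<Rightarrow> real \<Rightarrow> real) \<Rightarrow> (nat \<Rightarrow> real \<Rightarrow> real) \<Rightarrow> bool" where
  "kuramoto_solution N G \<Omega> \<kappa> \<tau> \<theta>0 \<theta> \<longleftrightarrow>
     (\<forall>i\<in>{1..N}.
        continuous_on {- max_delay N \<tau>..} (\<theta> i) \<and>
        (\<forall>t\<in>{- max_delay N \<tau>..0}. \<theta> i t = \<theta>0 i t) \<and>
        (\<forall>t>0. (\<theta> i has_real_derivative
                  \<Omega> i + \<kappa> / (real N - 1) *
                    (\<Sum>j\<in>{1..N} - {i}. chi G i j * sin (\<theta> j (t - \<tau> i j) - \<theta> i t))) (at t)))"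

definition omega :: "(nat \<Rightarrow> real \<Rightarrow> real) \<Rightarrow> nat \<Rightarrow> real \<Rightarrow> real" where
  "omega \<theta> i t = (if t = 0 then Lim (at_left 0) (deriv (\<theta> i)) else deriv (\<theta> i) t)"

definition d_theta :: "nat \<Rightarrow> (nat \<Rightarrow> real \<Rightarrow> real) \<Rightarrow> real \<Rightarrow> real" where
  "d_theta N \<theta> t = (MAX (i, j)\<in>{1..N} \<times> {1..N}. \<bar>\<theta> i t - \<theta> j t\<bar>)"

definition d_omega :: "nat \<Rightarrow> (nat \<Rightarrow> real \<Rightarrow> real) \<Rightarrow> real \<Rightarrow> real" where
  "d_omega N \<theta> t = (MAX (i, j)\<in>{1..N} \<times> {1..N}. \<bar>omega \<theta> i t - omega \<theta> j t\<bar>)"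

definition D_Omega :: "nat \<Rightarrow> (nat \<Rightarrow> real) \<Rightarrow> real" where
  "D_Omega N \<Omega> = (MAX (i, j)\<in>{1..N} \<times> {1..N}. \<bar>\<Omega> i - \<Omega> j\<bar>)"

text \<open>
  The inner maximum runs over an infinite set, for which \<open>Max\<close> is unspecified; for functions that
  are continuous on \<open>[-max_delay, 0]\<close> it is attained and equals the supremum.
\<close>

definition D_theta0 :: "nat \<Rightarrow> (nat \<Rightarrow> nat \<Rightarrow> real) \<Rightarrow> (nat \<Rightarrow> real \<Rightarrow> real) \<Rightarrow> real" where
  "D_theta0 N \<tau> \<theta> = (MAX (i, j)\<in>{1..N} \<times> {1..N}.
     (SUP (s, t)\<in>{- max_delay N \<tau>..0} \<times> {- max_delay N \<tau>..0}. \<bar>\<theta> i s - \<theta> j t\<bar>))"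

definition R_omega :: "nat \<Rightarrow> (nat \<Rightarrow> real) \<Rightarrow> real \<Rightarrow> real" where
  "R_omega N \<Omega> \<kappa> = (MAX i\<in>{1..N}. \<bar>\<Omega> i\<bar>) + \<kappa>"

definition k_perms :: "nat \<Rightarrow> nat \<Rightarrow> real" where
  "k_perms m k = fact m / fact (m - k)"

end

theory Submission
  imports Defs
begin

text \<open>
  Two regimes are separated in time: the phases contract until they lie in
  an arc shorter than a quarter turn, and from then on the frequencies obey a linear averaging law.

  Contraction of the phases. The diameter of the phases alone is not a good Lyapunov function on a
  general strongly connected digraph, because the extreme oscillators may be influenced only by
  oscillators close to them. Instead the phases are sorted and averaged with weights
  \<open>w 1 < w 2 < \<dots> < w N\<close> that grow so fast that a single arc pulling the upper end of a gap down
  outweighs all the arcs pulling the lower oscillators up across that gap. Strong connectivity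
  supplies such an arc for every gap, whence the weighted mean of the sorted phases drifts down at
  a rate proportional to the diameter (\<open>sorted_drift\<close>, \<open>drift_of_maximiser\<close>). Reflecting the
  phases gives the same for the bottom. Weighting sorted phases is the same as
  maximising over all permutations (\<open>maximising_permutation_sorts\<close>), so the Lyapunov function is
  a maximum of finitely many differentiable functions, and no differentiability in time of the
  sorting is involved: it suffices to look at the first time at which one of these functions
  touches a barrier (\<open>finite_family_barrier\<close>).

  Delays cost at most \<open>sin (R T)\<close> per arc, because every phase moves with speed at most \<open>R\<close> after
  time \<open>0\<close>; on \<open>[0, T]\<close>, where delayed phases may be initial data, the diameter grows by at most
  \<open>2 R T\<close>, and the bound on \<open>tan (R T)\<close> keeps it below \<open>\<zeta>\<close>. From time \<open>T\<close> on an exponentially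
  decaying barrier applies (\<open>functional_below_barrier\<close>). The Lyapunov function controls the diameter up to the
  factor \<open>\<beta> = 1 - 2 / \<eta>\<close>; since \<open>\<zeta> < \<beta> \<xi>\<close> the diameter never exceeds \<open>\<xi>\<close>, where the sine is
  still bounded below by a chord, and the lower bound on \<open>\<kappa>\<close> lets the barrier
  settle below \<open>\<beta> dinf\<close>. So the diameter is eventually at most \<open>dinf\<close> (\<open>eventual_cohesion\<close>).

  Synchronisation of the frequencies. Differentiating the equation, the frequencies satisfy
  \<open>v i' = (\<Sum>j. a i j * (v j (t - \<tau> i j) - v i))\<close> with \<open>a i j = \<kappa> / (N - 1) * \<chi> i j * cos \<dots>\<close>, and the
  cosines are at least \<open>cos (dinf + R T) > 0\<close>. For such delayed averaging on a strongly connected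
  digraph the range of \<open>v\<close> over a window of length \<open>T\<close> shrinks by a fixed factor per fixed time,
  since a deviation from the maximum at one vertex spreads along paths (\<open>consensus\<close>).
\<close>

section \<open>A comparison principle for finite families\<close>

text \<open>
  A replacement for Dini derivatives of \<open>max F\<close>. At the first time at which some member reaches
  the barrier, that member is maximal, all others are still at or below \<open>b\<close>, and \<open>b - F i\<close> has just
  decreased to \<open>0\<close>; so its derivative cannot be positive. The condition \<open>touch\<close> may therefore use
  everything that is known about such a first contact.
\<close>

lemma finite_family_barrier:
  fixes F :: "'i \<Rightarrow> real \<Rightarrow> real" and b :: "real \<Rightarrow> real"
  assumes fin: "finite I"
    and contF: "\<And>i. i \<in> I \<Longrightarrow> continuous_on {a..} (F i)"
    and contb: "continuous_on {a..} b"
    and init: "\<And>i. i \<in> I \<Longrightarrow> F i a < b a"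
    and touch: "\<And>i t. \<lbrakk>i \<in> I; t > a; \<And>j s. \<lbrakk>j \<in> I; a \<le> s; s < t\<rbrakk> \<Longrightarrow> F j s < b s;
        \<And>j. j \<in> I \<Longrightarrow> F j t \<le> b t; F i t = b t\<rbrakk>
      \<Longrightarrow> \<exists>D D'. (F i has_real_derivative D) (at t) \<and> (b has_real_derivative D') (at t) \<and> D < D'"
    and i: "i \<in> I" and t: "t \<ge> a"
  shows "F i t < b t"
proof (rule ccontr)
  assume neg: "\<not> F i t < b t"
  define Bad where "Bad = (\<Union>j\<in>I. {s \<in> {a..}. b s \<le> F j s})"
  have clB: "closed Bad"
    unfolding Bad_def
    by (intro closed_UN fin continuous_on_closed_Collect_le ballI)
       (auto intro: contF contb)
  have tB: "t \<in> Bad" using neg i t by (force simp: Bad_def)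
  have bdd: "bdd_below Bad" by (auto simp: Bad_def intro!: bdd_belowI[of _ a])
  define t1 where "t1 = Inf Bad"
  have "t1 \<in> Bad" unfolding t1_def using closed_contains_Inf[OF _ bdd clB] tB by auto
  then obtain k where k: "k \<in> I" "a \<le> t1" "b t1 \<le> F k t1" by (auto simp: Bad_def)
  have before: "F j s < b s" if "j \<in> I" "a \<le> s" "s < t1" for j s
    using cInf_lower[OF _ bdd, of s] that unfolding t1_def[symmetric]
    by (force simp: Bad_def)
  have "t1 \<noteq> a" using init[OF k(1)] k(3) by auto
  with k have t1a: "t1 > a" by simp
  have le: "F j t1 \<le> b t1" if j: "j \<in> I" for j
  proof -
    have "((\<lambda>s. b s - F j s) \<longlongrightarrow> b t1 - F j t1) (at t1 within {a..})"
      using contF[OF j] contb k(2) by (auto simp: continuous_on_def intro!: tendsto_diff)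
    then have l: "((\<lambda>s. b s - F j s) \<longlongrightarrow> b t1 - F j t1) (at t1 within {a<..<t1})"
      by (rule tendsto_within_subset) auto
    have "eventually (\<lambda>s. 0 \<le> b s - F j s) (at t1 within {a<..<t1})"
      using before[OF j] by (auto simp: eventually_at_filter intro!: always_eventually less_imp_le)
    moreover have "at t1 within {a<..<t1} \<noteq> bot"
      using t1a by (simp add: at_within_eq_bot_iff)
    ultimately have "0 \<le> b t1 - F j t1" using tendsto_lowerbound[OF l] by blast
    then show ?thesis by simp
  qed
  have eq: "F k t1 = b t1" using le[OF k(1)] k(3) by simp
  from touch[OF k(1) t1a before le eq] obtain D D' where
    d: "(F k has_real_derivative D) (at t1)" "(b has_real_derivative D') (at t1)" "D < D'" by blast
  have "((\<lambda>s. b s - F k s) has_real_derivative D' - D) (at t1)"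
    using d by (auto intro!: derivative_eq_intros)
  from DERIV_pos_inc_left[OF this] d(3) obtain e where
    e: "e > 0" "\<And>h. 0 < h \<Longrightarrow> h < e \<Longrightarrow> b (t1 - h) - F k (t1 - h) < b t1 - F k t1" by auto
  \<comment> \<open>A step to the left of the first contact, short enough for the derivative estimate and not beyond \<open>a\<close>.\<close>
  define h where "h = min (e / 2) (t1 - a)"
  have h: "0 < h" "h < e" "h \<le> t1 - a" using e t1a by (auto simp: h_def)
  from e(2)[OF h(1,2)] before[OF k(1), of "t1 - h"] h eq show False by simp
qed

section \<open>Consensus for linear averaging with delays\<close>

text \<open>
  Gronwall's inequality for \<open>z' \<ge> h - K z\<close>: the function \<open>exp (K t) * (z t - h / K)\<close> is nondecreasing.
\<close>

lemma linear_lower_bound: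
  fixes z :: "real \<Rightarrow> real" and h K p q :: real
  assumes d: "\<And>t. p \<le> t \<Longrightarrow> t \<le> q \<Longrightarrow> \<exists>D. (z has_real_derivative D) (at t) \<and> D \<ge> h - K * z t"
    and "p \<le> q" and "K > 0"
  shows "z q - h / K \<ge> exp (- K * (q - p)) * (z p - h / K)"
proof -
  let ?g = "\<lambda>t. exp (K * t) * (z t - h / K)"
  have "?g p \<le> ?g q"
  proof (rule DERIV_nonneg_imp_nondecreasing[OF \<open>p \<le> q\<close>])
    fix t assume t: "p \<le> t" "t \<le> q"
    from d[OF t] obtain D where D: "(z has_real_derivative D) (at t)" "D \<ge> h - K * z t" by blast
    have "(?g has_real_derivative exp (K * t) * (K * (z t - h / K) + D)) (at t)"
      by (auto intro!: derivative_eq_intros D(1) simp: algebra_simps)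
    moreover have "0 \<le> K * (z t - h / K) + D" using D(2) \<open>K > 0\<close> by (simp add: algebra_simps)
    ultimately show "\<exists>y. (?g has_real_derivative y) (at t) \<and> y \<ge> 0" by (meson exp_ge_zero mult_nonneg_nonneg)
  qed
  then have "exp (- K * q) * ?g p \<le> exp (- K * q) * ?g q" by (intro mult_left_mono) auto
  then show ?thesis by (simp add: exp_diff exp_minus field_simps right_diff_distrib)
qed

text \<open>
  Solutions on \<open>[t0, \<infinity>)\<close> with history on \<open>[t0 - T, t0]\<close>. The law is affine invariant, so that upper
  and lower bounds on \<open>v\<close> are both statements about nonnegative solutions.
\<close>

definition consensus_flow ::
  "nat set \<Rightarrow> (nat \<Rightarrow> nat \<Rightarrow> real) \<Rightarrow> (nat \<Rightarrow> nat \<Rightarrow> real \<Rightarrow> real) \<Rightarrow> real \<Rightarrow> real \<Rightarrow> (nat \<Rightarrow> real \<Rightarrow> real) \<Rightarrow> bool"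
where
  "consensus_flow V \<tau> a T t0 v \<longleftrightarrow>
     (\<forall>i\<in>V. continuous_on {t0 - T..} (v i) \<and>
        (\<forall>t\<ge>t0. (v i has_real_derivative (\<Sum>j\<in>V. a i j t * (v j (t - \<tau> i j) - v i t))) (at t)))"

lemma consensus_flow_reflect:
  assumes "consensus_flow V \<tau> a T t0 v"
  shows "consensus_flow V \<tau> a T t0 (\<lambda>i t. M - v i t)"
  unfolding consensus_flow_def
proof (intro ballI conjI allI impI)
  fix i assume i: "i \<in> V"
  show "continuous_on {t0 - T..} (\<lambda>t. M - v i t)"
    using assms i by (auto simp: consensus_flow_def intro!: continuous_intros)
  fix t assume t: "t \<ge> t0"
  have "((\<lambda>t. M - v i t) has_real_derivative - (\<Sum>j\<in>V. a i j t * (v j (t - \<tau> i j) - v i t))) (at t)"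
    using assms i t by (auto simp: consensus_flow_def intro!: derivative_eq_intros)
  also have "- (\<Sum>j\<in>V. a i j t * (v j (t - \<tau> i j) - v i t))
      = (\<Sum>j\<in>V. a i j t * ((M - v j (t - \<tau> i j)) - (M - v i t)))"
    by (simp add: sum_negf[symmetric] algebra_simps)
  finally show "((\<lambda>t. M - v i t) has_real_derivative
      (\<Sum>j\<in>V. a i j t * ((M - v j (t - \<tau> i j)) - (M - v i t)))) (at t)" .
qed

lemma consensus_flow_shift:
  assumes "consensus_flow V \<tau> a T t0 v"
  shows "consensus_flow V \<tau> a T t0 (\<lambda>i t. v i t - m)"
proof -
  have "consensus_flow V \<tau> a T t0 (\<lambda>i t. - m - (0 - v i t))"
    by (intro consensus_flow_reflect assms)
  then show ?thesis by simp
qed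

locale delayed_weights =
  fixes V :: "nat set" and \<tau> :: "nat \<Rightarrow> nat \<Rightarrow> real" and a :: "nat \<Rightarrow> nat \<Rightarrow> real \<Rightarrow> real"
    and T t0 K a0 :: real and E :: "(nat \<times> nat) set"
  assumes finV: "finite V"
    and delay: "\<And>i j. \<lbrakk>i \<in> V; j \<in> V\<rbrakk> \<Longrightarrow> 0 \<le> \<tau> i j \<and> \<tau> i j \<le> T"
    and wnonneg: "\<And>i j t. \<lbrakk>i \<in> V; j \<in> V; t \<ge> t0\<rbrakk> \<Longrightarrow> 0 \<le> a i j t"
    and wsum: "\<And>i t. \<lbrakk>i \<in> V; t \<ge> t0\<rbrakk> \<Longrightarrow> (\<Sum>j\<in>V. a i j t) \<le> K"
    and Kpos: "K > 0" and Tnn: "T \<ge> 0" and a0pos: "a0 > 0" and a0K: "a0 \<le> K"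
    and EV: "E \<subseteq> V \<times> V"
    and wE: "\<And>i j t. \<lbrakk>(i, j) \<in> E; t \<ge> t0\<rbrakk> \<Longrightarrow> a0 \<le> a i j t"
begin

text \<open>
  At a first contact of \<open>- z i\<close> with the slowly rising barrier \<open>e * (1 + (t - s))\<close>, all values that
  \<open>i\<close> sees are at least \<open>z i\<close>, hence \<open>z i\<close> is not decreasing. Letting \<open>e\<close> tend to \<open>0\<close> gives the claim.
\<close>

lemma flow_nonneg:
  assumes fl: "consensus_flow V \<tau> a T t0 z" and s: "s \<ge> t0"
    and hist: "\<And>j u. \<lbrakk>j \<in> V; s - T \<le> u; u \<le> s\<rbrakk> \<Longrightarrow> 0 \<le> z j u"
    and i: "i \<in> V" and t: "t \<ge> s - T"
  shows "0 \<le> z i t"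
proof (cases "t \<le> s")
  case True then show ?thesis using hist i t by auto
next
  case False
  then have ts: "t \<ge> s" by simp
  have approx: "- z i t < e * (1 + (t - s))" if e: "e > 0" for e
  proof (rule finite_family_barrier[where I = V and F = "\<lambda>i t. - z i t" and a = s
        and b = "\<lambda>t. e * (1 + (t - s))"])
    show "finite V" "i \<in> V" "s \<le> t" using finV i ts by auto
    show "continuous_on {s..} (\<lambda>t. - z j t)" if "j \<in> V" for j
    proof -
      have "continuous_on {t0 - T..} (z j)" using fl that by (auto simp: consensus_flow_def)
      then have "continuous_on {s..} (z j)" by (rule continuous_on_subset) (use s Tnn in auto)
      then show ?thesis by (intro continuous_intros)
    qed
    show "continuous_on {s..} (\<lambda>t. e * (1 + (t - s)))" by (intro continuous_intros)
    show "- z j s < e * (1 + (s - s))" if "j \<in> V" for j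
    proof -
      have "0 \<le> z j s" using hist[OF that, of s] Tnn by simp
      then show ?thesis using e by simp
    qed
    fix k u assume k: "k \<in> V" and u: "u > s"
      and before: "\<And>j r. \<lbrakk>j \<in> V; s \<le> r; r < u\<rbrakk> \<Longrightarrow> - z j r < e * (1 + (r - s))"
      and le: "\<And>j. j \<in> V \<Longrightarrow> - z j u \<le> e * (1 + (u - s))"
      and eq: "- z k u = e * (1 + (u - s))"
    let ?D = "\<Sum>j\<in>V. a k j u * (z j (u - \<tau> k j) - z k u)"
    have d: "(z k has_real_derivative ?D) (at u)"
      using fl k u s by (auto simp: consensus_flow_def)
    have low: "z k u \<le> z j (u - \<tau> k j)" if j: "j \<in> V" for j
    proof -
      have dl: "0 \<le> \<tau> k j" "\<tau> k j \<le> T" using delay[OF k j] by auto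
      consider "u - \<tau> k j < s" | "s \<le> u - \<tau> k j" "u - \<tau> k j < u" | "u - \<tau> k j = u"
        using dl by linarith
      then show ?thesis
      proof cases
        case 1
        have "0 \<le> z j (u - \<tau> k j)" using hist[OF j] 1 dl u by auto
        moreover have "0 \<le> e * (1 + (u - s))" using e u by simp
        ultimately show ?thesis using eq by linarith
      next
        case 2
        have "- z j (u - \<tau> k j) < e * (1 + (u - \<tau> k j - s))" using before[OF j 2] .
        also have "\<dots> \<le> e * (1 + (u - s))" using e dl by (intro mult_left_mono) auto
        finally show ?thesis using eq by linarith
      next
        case 3 then show ?thesis using le[OF j] eq by simp
      qed
    qed
    have "0 \<le> ?D"
      using low wnonneg[OF k] u s by (intro sum_nonneg mult_nonneg_nonneg) auto
    moreover have "((\<lambda>t. - z k t) has_real_derivative - ?D) (at u)"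
      using d by (rule DERIV_minus)
    moreover have "((\<lambda>t. e * (1 + (t - s))) has_real_derivative e) (at u)"
      by (auto intro!: derivative_eq_intros)
    ultimately show "\<exists>D D'. ((\<lambda>t. - z k t) has_real_derivative D) (at u) \<and>
        ((\<lambda>t. e * (1 + (t - s))) has_real_derivative D') (at u) \<and> D < D'"
      using e by (intro exI[of _ "- ?D"] exI[of _ e]) auto
  qed
  show ?thesis
  proof (rule ccontr)
    assume "\<not> 0 \<le> z i t"
    then have p: "- z i t > 0" by simp
    define e where "e = - z i t / (1 + (t - s))"
    have "e > 0" unfolding e_def using p ts by (intro divide_pos_pos) auto
    from approx[OF this] show False using ts by (simp add: e_def)
  qed
qed

text \<open>
  Dropping the nonnegative contributions of the vertices outside \<open>A\<close>. It is applied with \<open>A = {}\<close> for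
  the decay estimate and with a singleton for the influence of one neighbour.
\<close>

lemma flow_derivative_lower:
  assumes fl: "consensus_flow V \<tau> a T t0 z" and i: "i \<in> V" and t: "t \<ge> t0"
    and nn: "\<And>j u. \<lbrakk>j \<in> V; u \<ge> t - T\<rbrakk> \<Longrightarrow> 0 \<le> z j u"
    and hb: "A \<subseteq> V" "\<And>j. j \<in> A \<Longrightarrow> e \<le> a i j t * z j (t - \<tau> i j)"
  shows "\<exists>D. (z i has_real_derivative D) (at t) \<and> D \<ge> (\<Sum>j\<in>A. e) - K * z i t"
proof -
  let ?D = "\<Sum>j\<in>V. a i j t * (z j (t - \<tau> i j) - z i t)"
  have "(z i has_real_derivative ?D) (at t)" using fl i t by (auto simp: consensus_flow_def)
  moreover have "?D = (\<Sum>j\<in>V. a i j t * z j (t - \<tau> i j)) - (\<Sum>j\<in>V. a i j t) * z i t"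
    by (simp add: right_diff_distrib sum_subtractf sum_distrib_right)
  moreover have "(\<Sum>j\<in>V. a i j t) * z i t \<le> K * z i t"
    using wsum[OF i t] nn[OF i, of t] Tnn by (intro mult_right_mono) auto
  moreover have "(\<Sum>j\<in>A. e) \<le> (\<Sum>j\<in>A. a i j t * z j (t - \<tau> i j))"
    by (intro sum_mono hb)
  moreover have "(\<Sum>j\<in>A. a i j t * z j (t - \<tau> i j)) \<le> (\<Sum>j\<in>V. a i j t * z j (t - \<tau> i j))"
  proof (intro sum_mono2 finV hb mult_nonneg_nonneg)
    fix j assume j: "j \<in> V - A"
    then show "0 \<le> a i j t" using wnonneg[OF i _ t] by auto
    show "0 \<le> z j (t - \<tau> i j)" using j delay[OF i, of j] by (intro nn) auto
  qed
  ultimately show ?thesis by (intro exI[of _ ?D]) linarith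
qed

text \<open>
  A lower bound for the fraction of a neighbour's value that is picked up along one arc in one unit
  of time.
\<close>

definition \<rho> where "\<rho> = a0 / K * (1 - exp (- K))"

lemma rho: "0 < \<rho>" "\<rho> \<le> 1"
proof -
  show "0 < \<rho>" using a0pos Kpos by (simp add: \<rho>_def)
  have "\<rho> \<le> 1 * 1" unfolding \<rho>_def using a0pos Kpos a0K by (intro mult_mono) auto
  then show "\<rho> \<le> 1" by simp
qed

lemma flow_persists:
  assumes fl: "consensus_flow V \<tau> a T t0 z" and s: "s \<ge> t0"
    and nn: "\<And>j u. \<lbrakk>j \<in> V; u \<ge> s - T\<rbrakk> \<Longrightarrow> 0 \<le> z j u"
    and i: "i \<in> V" and t: "t \<ge> s"
  shows "z i t \<ge> exp (- K * (t - s)) * z i s"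
proof -
  have "z i t - 0 / K \<ge> exp (- K * (t - s)) * (z i s - 0 / K)"
  proof (rule linear_lower_bound[OF _ t Kpos])
    fix u assume u: "s \<le> u" "u \<le> t"
    have nn': "0 \<le> z j r" if "j \<in> V" "r \<ge> u - T" for j r using nn[OF that(1), of r] that u by simp
    show "\<exists>D. (z i has_real_derivative D) (at u) \<and> 0 - K * z i u \<le> D"
      using flow_derivative_lower[OF fl i _ nn', of u "{}" 0] u s by auto
  qed
  then show ?thesis by simp
qed

text \<open>
  The waiting time is \<open>T\<close>, after which the delayed value of \<open>j\<close> lies in the interval where it is known
  to be large, plus \<open>1\<close>, during which \<open>z i\<close> relaxes towards \<open>a0 * \<epsilon> / K\<close>.
\<close>

lemma flow_spreads:
  assumes fl: "consensus_flow V \<tau> a T t0 z" and s: "s \<ge> t0"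
    and nn: "\<And>j u. \<lbrakk>j \<in> V; u \<ge> s - T\<rbrakk> \<Longrightarrow> 0 \<le> z j u"
    and e: "(i, j) \<in> E" and low: "\<And>t. \<lbrakk>s \<le> t; t \<le> q\<rbrakk> \<Longrightarrow> \<epsilon> \<le> z j t" and eps: "\<epsilon> \<ge> 0"
    and t: "s + (T + 1) \<le> t" "t \<le> q"
  shows "\<rho> * \<epsilon> \<le> z i t"
proof -
  have ij: "i \<in> V" "j \<in> V" using e EV by auto
  have pt: "s + T \<le> t" using t by simp
  have main: "z i t - a0 * \<epsilon> / K \<ge> exp (- K * (t - (s + T))) * (z i (s + T) - a0 * \<epsilon> / K)"
  proof (rule linear_lower_bound[OF _ pt Kpos])
    fix u assume u: "s + T \<le> u" "u \<le> t"
    have nn': "0 \<le> z j r" if "j \<in> V" "r \<ge> u - T" for j r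
      using nn[OF that(1), of r] that u Tnn by simp
    have ut0: "u \<ge> t0" using u s Tnn by simp
    have "a0 * \<epsilon> \<le> a i j u * z j (u - \<tau> i j)"
    proof (rule mult_mono)
      show "a0 \<le> a i j u" using wE[OF e ut0] .
      show "\<epsilon> \<le> z j (u - \<tau> i j)" using delay[OF ij] u t by (intro low) auto
      show "0 \<le> a i j u" using wnonneg[OF ij ut0] .
    qed (rule eps)
    then show "\<exists>D. (z i has_real_derivative D) (at u) \<and> a0 * \<epsilon> - K * z i u \<le> D"
      using flow_derivative_lower[OF fl ij(1) ut0 nn', of "{j}" "a0 * \<epsilon>"] ij by auto
  qed
  have zp: "0 \<le> z i (s + T)" using nn[OF ij(1)] Tnn by simp
  have "exp (- K * (t - (s + T))) * (z i (s + T) - a0 * \<epsilon> / K)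
      \<ge> exp (- K * (t - (s + T))) * (- (a0 * \<epsilon> / K))"
    using zp by (intro mult_left_mono) auto
  moreover have "exp (- K * (t - (s + T))) * (a0 * \<epsilon> / K) \<le> exp (- K) * (a0 * \<epsilon> / K)"
    using t Kpos a0pos eps by (intro mult_right_mono) auto
  ultimately have "z i t \<ge> a0 * \<epsilon> / K - exp (- K) * (a0 * \<epsilon> / K)" using main by simp
  then show ?thesis by (simp add: \<rho>_def algebra_simps)
qed

lemma flow_spreads_along_path:
  assumes fl: "consensus_flow V \<tau> a T t0 z" and s: "s \<ge> t0"
    and nn: "\<And>j u. \<lbrakk>j \<in> V; u \<ge> s - T\<rbrakk> \<Longrightarrow> 0 \<le> z j u"
    and low: "\<And>t. \<lbrakk>s \<le> t; t \<le> q\<rbrakk> \<Longrightarrow> \<epsilon> \<le> z j t" and eps: "\<epsilon> \<ge> 0"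
    and path: "(i, j) \<in> E ^^ n"
    and t: "s + real n * (T + 1) \<le> t" "t \<le> q"
  shows "\<rho> ^ n * \<epsilon> \<le> z i t"
  using path t
proof (induction n arbitrary: i t)
  case 0
  then show ?case using low by auto
next
  case (Suc n)
  then obtain k where k: "(i, k) \<in> E" "(k, j) \<in> E ^^ n" by (meson relpow_Suc_D2)
  let ?s = "s + real n * (T + 1)"
  have ss: "?s \<ge> s" using Tnn by simp
  have "\<rho> * (\<rho> ^ n * \<epsilon>) \<le> z i t"
  proof (rule flow_spreads[OF fl _ _ k(1), where s = ?s and q = q])
    show "?s \<ge> t0" using ss s by simp
    show "0 \<le> z l u" if "l \<in> V" "?s - T \<le> u" for l u using nn[OF that(1), of u] that ss by simp
    show "\<rho> ^ n * \<epsilon> \<le> z k u" if "?s \<le> u" "u \<le> q" for u using Suc.IH[OF k(2)] that by simp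
    show "0 \<le> \<rho> ^ n * \<epsilon>" using rho eps by simp
    show "?s + (T + 1) \<le> t" using Suc.prems by (simp add: algebra_simps)
    show "t \<le> q" by fact
  qed
  then show ?case by simp
qed

end

locale connected_delayed_weights = delayed_weights +
  assumes conn: "\<And>i j. \<lbrakk>i \<in> V; j \<in> V\<rbrakk> \<Longrightarrow> (i, j) \<in> E\<^sup>*" and neV: "V \<noteq> {}"
begin

lemma bounded_path_length:
  "\<exists>L. \<forall>i\<in>V. \<forall>j\<in>V. \<exists>n\<le>L. (i, j) \<in> E ^^ n"
proof -
  have "\<forall>x\<in>V \<times> V. \<exists>n. x \<in> E ^^ n" using conn by (auto simp: rtrancl_power)
  then obtain f where f: "\<And>x. x \<in> V \<times> V \<Longrightarrow> x \<in> E ^^ f x" by metis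
  show ?thesis
  proof (rule exI[of _ "Max (f ` (V \<times> V))"], intro ballI)
    fix i j assume "i \<in> V" "j \<in> V"
    then show "\<exists>n\<le>Max (f ` (V \<times> V)). (i, j) \<in> E ^^ n"
      using f[of "(i, j)"] finV by (intro exI[of _ "f (i, j)"]) auto
  qed
qed

text \<open>
  Positivity at one vertex at one time becomes a uniform lower bound at all vertices, over a whole
  window of length \<open>T\<close> ending \<open>H\<close> later. The vertex itself keeps the fraction \<open>exp (- K H)\<close> of its
  value, and this then travels along paths of at most \<open>L\<close> arcs.
\<close>

lemma one_sided_gain:
  "\<exists>H \<gamma>. H > 0 \<and> 0 < \<gamma> \<and> \<gamma> < 1 \<and>
    (\<forall>z s u \<epsilon> i t. consensus_flow V \<tau> a T t0 z \<longrightarrow> s \<ge> t0 \<longrightarrow>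
       (\<forall>j\<in>V. \<forall>r\<ge>s - T. 0 \<le> z j r) \<longrightarrow> u \<in> V \<longrightarrow> 0 \<le> \<epsilon> \<longrightarrow> \<epsilon> \<le> z u s \<longrightarrow>
       i \<in> V \<longrightarrow> s + H - T \<le> t \<longrightarrow> t \<le> s + H \<longrightarrow> \<gamma> * \<epsilon> \<le> z i t)"
proof -
  obtain L where L: "\<And>i j. \<lbrakk>i \<in> V; j \<in> V\<rbrakk> \<Longrightarrow> \<exists>n\<le>L. (i, j) \<in> E ^^ n"
    using bounded_path_length by blast
  define H where "H = real L * (T + 1) + T + 1"
  define \<gamma> where "\<gamma> = \<rho> ^ L * exp (- K * H)"
  have H: "H > 0" using Tnn by (simp add: H_def add_nonneg_pos)
  have g0: "0 < \<gamma>" using rho by (simp add: \<gamma>_def)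
  have "\<gamma> \<le> 1 * exp (- K * H)"
    unfolding \<gamma>_def using rho by (intro mult_right_mono power_le_one) auto
  also have "\<dots> < 1" using Kpos H by simp
  finally have g1: "\<gamma> < 1" .
  have "\<gamma> * \<epsilon> \<le> z i t"
    if fl: "consensus_flow V \<tau> a T t0 z" and s: "s \<ge> t0"
      and nn: "\<forall>j\<in>V. \<forall>r\<ge>s - T. 0 \<le> z j r" and u: "u \<in> V" and eps: "0 \<le> \<epsilon>" "\<epsilon> \<le> z u s"
      and i: "i \<in> V" and t: "s + H - T \<le> t" "t \<le> s + H" for z s u \<epsilon> i t
  proof -
    obtain n where n: "n \<le> L" "(i, u) \<in> E ^^ n" using L[OF i u] by blast
    have "\<rho> ^ n * (exp (- K * H) * \<epsilon>) \<le> z i t"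
    proof (rule flow_spreads_along_path[OF fl s _ _ _ n(2), where q = "s + H"])
      show "0 \<le> z j r" if "j \<in> V" "r \<ge> s - T" for j r using nn that by blast
      show "0 \<le> exp (- K * H) * \<epsilon>" using eps by simp
      have "real n * (T + 1) \<le> real L * (T + 1)" using n Tnn by (intro mult_right_mono) auto
      then show "s + real n * (T + 1) \<le> t" using t unfolding H_def by linarith
      show "t \<le> s + H" by fact
      fix r assume r: "s \<le> r" "r \<le> s + H"
      have "exp (- K * H) * \<epsilon> \<le> exp (- K * (r - s)) * z u s"
        using r Kpos eps by (intro mult_mono) auto
      also have "\<dots> \<le> z u r" using flow_persists[OF fl s _ u r(1)] nn by blast
      finally show "exp (- K * H) * \<epsilon> \<le> z u r" .
    qed
    moreover have "\<rho> ^ L \<le> \<rho> ^ n" using rho n by (intro power_decreasing) auto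
    then have "\<rho> ^ L * (exp (- K * H) * \<epsilon>) \<le> \<rho> ^ n * (exp (- K * H) * \<epsilon>)"
      using eps by (intro mult_right_mono) auto
    ultimately show ?thesis unfolding \<gamma>_def mult.assoc by linarith
  qed
  then show ?thesis using H g0 g1 by (intro exI[of _ H] exI[of _ \<gamma>]) blast
qed

text \<open>
  If all values lie in \<open>[m, M]\<close>, then the value at any chosen vertex \<open>w\<close> is at distance at least
  \<open>(M - m) / 2\<close> from one of the two ends; the gain lemma, applied to \<open>M - v\<close> or \<open>v - m\<close>, moves that
  end inwards for all vertices. Hence the range shrinks by the factor \<open>1 - \<gamma> / 2\<close> in each period \<open>H\<close>.
\<close>

theorem consensus:
  assumes fl: "consensus_flow V \<tau> a T t0 v" and ij: "i \<in> V" "j \<in> V"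
  shows "((\<lambda>t. v i t - v j t) \<longlongrightarrow> 0) at_top"
proof -
  obtain H \<gamma> where H: "H > 0" and g: "0 < \<gamma>" "\<gamma> < 1" and gain0:
    "\<forall>z s u \<epsilon> i t. consensus_flow V \<tau> a T t0 z \<longrightarrow> s \<ge> t0 \<longrightarrow>
       (\<forall>j\<in>V. \<forall>r\<ge>s - T. 0 \<le> z j r) \<longrightarrow> u \<in> V \<longrightarrow> 0 \<le> \<epsilon> \<longrightarrow> \<epsilon> \<le> z u s \<longrightarrow>
       i \<in> V \<longrightarrow> s + H - T \<le> t \<longrightarrow> t \<le> s + H \<longrightarrow> \<gamma> * \<epsilon> \<le> z i t"
    using one_sided_gain by blast
  have gain: "\<gamma> * \<epsilon> \<le> z i t"
    if "consensus_flow V \<tau> a T t0 z" "s \<ge> t0" "\<And>j r. \<lbrakk>j\<in>V; r\<ge>s - T\<rbrakk> \<Longrightarrow> 0 \<le> z j r"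
      "u \<in> V" "0 \<le> \<epsilon>" "\<epsilon> \<le> z u s" "i \<in> V" "s + H - T \<le> t" "t \<le> s + H" for z s u \<epsilon> i t
    using gain0 that by blast
  define inside where "inside m M s \<longleftrightarrow> (\<forall>j\<in>V. \<forall>r\<ge>s - T. m \<le> v j r \<and> v j r \<le> M)" for m M s
  have stay: "inside m M s"
    if s: "s \<ge> t0" and h: "\<And>j r. \<lbrakk>j \<in> V; s - T \<le> r; r \<le> s\<rbrakk> \<Longrightarrow> m \<le> v j r \<and> v j r \<le> M" for m M s
    unfolding inside_def
  proof (intro ballI allI impI)
    fix j r assume jr: "j \<in> V" "s - T \<le> r"
    have "0 \<le> M - v j r"
      using flow_nonneg[OF consensus_flow_reflect[OF fl, of M] s _ jr] h by simp
    moreover have "0 \<le> v j r - m"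
      using flow_nonneg[OF consensus_flow_shift[OF fl, of m] s _ jr] h by simp
    ultimately show "m \<le> v j r \<and> v j r \<le> M" by simp
  qed
  obtain w where w: "w \<in> V" using neV by blast
  define q where "q = 1 - \<gamma> / 2"
  have q: "0 < q" "q < 1" using g by (auto simp: q_def)
  have contract: "\<exists>m' M'. M' - m' = q * (M - m) \<and> inside m' M' (s + H)"
    if s: "s \<ge> t0" and ins: "inside m M s" for m M s
  proof -
    have b: "m \<le> v j r" "v j r \<le> M" if "j \<in> V" "r \<ge> s - T" for j r
      using ins that by (auto simp: inside_def)
    define \<Delta> where "\<Delta> = (M - m) / 2"
    have D0: "\<Delta> \<ge> 0" using b[OF w, of s] Tnn by (simp add: \<Delta>_def)
    consider "\<Delta> \<le> M - v w s" | "\<Delta> \<le> v w s - m"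
      by (cases "\<Delta> \<le> M - v w s") (auto simp: \<Delta>_def field_simps)
    then show ?thesis
    proof cases
      case 1
      have "inside m (M - \<gamma> * \<Delta>) (s + H)"
      proof (rule stay)
        fix j r assume jr: "j \<in> V" "s + H - T \<le> r" "r \<le> s + H"
        have "\<gamma> * \<Delta> \<le> M - v j r"
          using gain[OF consensus_flow_reflect[OF fl, of M] s _ w D0 1 jr] b by simp
        then show "m \<le> v j r \<and> v j r \<le> M - \<gamma> * \<Delta>" using b(1)[OF jr(1), of r] jr H by simp
      qed (use s H in simp)
      moreover have "M - \<gamma> * \<Delta> - m = q * (M - m)" by (simp add: q_def \<Delta>_def algebra_simps)
      ultimately show ?thesis by blast
    next
      case 2
      have "inside (m + \<gamma> * \<Delta>) M (s + H)"
      proof (rule stay)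
        fix j r assume jr: "j \<in> V" "s + H - T \<le> r" "r \<le> s + H"
        have "\<gamma> * \<Delta> \<le> v j r - m"
          using gain[OF consensus_flow_shift[OF fl, of m] s _ w D0 2 jr] b by simp
        then show "m + \<gamma> * \<Delta> \<le> v j r \<and> v j r \<le> M" using b(2)[OF jr(1), of r] jr H by simp
      qed (use s H in simp)
      moreover have "M - (m + \<gamma> * \<Delta>) = q * (M - m)" by (simp add: q_def \<Delta>_def algebra_simps)
      ultimately show ?thesis by blast
    qed
  qed
  have "\<exists>B. \<forall>j\<in>V. \<forall>r\<in>{t0 - T..t0}. \<bar>v j r\<bar> \<le> B"
  proof -
    have "bounded (\<Union>j\<in>V. v j ` {t0 - T..t0})"
    proof (intro bounded_UN finV ballI compact_imp_bounded compact_continuous_image compact_Icc)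
      fix j assume "j \<in> V"
      then have "continuous_on {t0 - T..} (v j)" using fl by (auto simp: consensus_flow_def)
      then show "continuous_on {t0 - T..t0} (v j)" by (rule continuous_on_subset) auto
    qed
    then show ?thesis unfolding bounded_iff by fastforce
  qed
  then obtain B where B: "\<And>j r. \<lbrakk>j \<in> V; t0 - T \<le> r; r \<le> t0\<rbrakk> \<Longrightarrow> \<bar>v j r\<bar> \<le> B"
    by (metis atLeastAtMost_iff)
  have windows: "\<exists>m M. M - m = q ^ n * (2 * B) \<and> inside m M (t0 + real n * H)" for n
  proof (induction n)
    case 0
    have "inside (- B) B t0" using B by (intro stay) (auto simp: abs_le_iff minus_le_iff)
    then show ?case by (intro exI[of _ "-B"] exI[of _ B]) auto
  next
    case (Suc n)
    then obtain m M where mM: "M - m = q ^ n * (2 * B)" "inside m M (t0 + real n * H)" by blast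
    have "t0 + real n * H \<ge> t0" using H by simp
    from contract[OF this mM(2)] obtain m' M' where
      "M' - m' = q * (M - m)" "inside m' M' (t0 + real n * H + H)" by blast
    then show ?case using mM(1) by (intro exI[of _ m'] exI[of _ M']) (auto simp: algebra_simps)
  qed
  show ?thesis
  proof (rule tendstoI)
    fix e :: real assume e: "e > 0"
    have "(\<lambda>n. q ^ n * (2 * B)) \<longlonglongrightarrow> 0 * (2 * B)"
      using q by (intro tendsto_mult LIMSEQ_power_zero tendsto_const) auto
    then have "eventually (\<lambda>n. q ^ n * (2 * B) < e) sequentially"
      using e by (simp add: order_tendsto_iff)
    then obtain n where n: "q ^ n * (2 * B) < e" by (auto simp: eventually_sequentially)
    obtain m M where mM: "M - m = q ^ n * (2 * B)" "inside m M (t0 + real n * H)"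
      using windows by blast
    show "eventually (\<lambda>t. dist (v i t - v j t) 0 < e) at_top"
      using eventually_ge_at_top[of "t0 + real n * H"]
    proof eventually_elim
      case (elim t)
      then have "t \<ge> t0 + real n * H - T" using Tnn by simp
      then have "m \<le> v i t" "v i t \<le> M" "m \<le> v j t" "v j t \<le> M"
        using mM(2) ij by (auto simp: inside_def)
      then show ?case using mM(1) n by (simp add: dist_real_def abs_less_iff)
    qed
  qed
qed

end
section \<open>Trigonometric inequalities\<close>

lemma le_tan_self:
  fixes x :: real
  assumes "0 \<le> x" "x < pi / 2"
  shows "x \<le> tan x"
proof -
  have "tan 0 - 0 \<le> tan x - x"
  proof (rule DERIV_nonneg_imp_nondecreasing[OF assms(1)])
    fix y assume y: "0 \<le> y" "y \<le> x"
    have c: "0 < cos y" using y assms by (intro cos_gt_zero_pi) auto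
    have "((\<lambda>x. tan x - x) has_real_derivative inverse ((cos y)\<^sup>2) - 1) (at y)"
      using c by (auto intro!: derivative_eq_intros)
    moreover have "(cos y)\<^sup>2 \<le> 1" using c by (simp add: power_le_one)
    then have "1 \<le> inverse ((cos y)\<^sup>2)" using c by (simp add: one_le_inverse_iff)
    ultimately show "\<exists>d. ((\<lambda>x. tan x - x) has_real_derivative d) (at y) \<and> d \<ge> 0" by force
  qed
  then show ?thesis by simp
qed

lemma sin_subadditive_sum:
  fixes g :: "nat \<Rightarrow> real"
  assumes "p \<le> q" and "\<And>m. m \<in> {p..<q} \<Longrightarrow> 0 \<le> g m" and "(\<Sum>m\<in>{p..<q}. g m) \<le> pi"
  shows "sin (\<Sum>m\<in>{p..<q}. g m) \<le> (\<Sum>m\<in>{p..<q}. sin (g m))"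
  using assms
proof (induction q rule: dec_induct)
  case base then show ?case by simp
next
  case (step q)
  let ?s = "\<Sum>m\<in>{p..<q}. g m"
  have split: "(\<Sum>m\<in>{p..<Suc q}. h m) = (\<Sum>m\<in>{p..<q}. h m) + h q" for h :: "nat \<Rightarrow> real"
    using step.hyps by (simp add: sum.atLeastLessThan_Suc not_less)
  have s0: "0 \<le> ?s" and gq: "0 \<le> g q" using step by (auto intro!: sum_nonneg)
  have tot: "?s + g q \<le> pi" using step.prems(2) split[of g] by simp
  have IH: "sin ?s \<le> (\<Sum>m\<in>{p..<q}. sin (g m))" using step s0 gq tot by auto
  have "sin (?s + g q) = sin ?s * cos (g q) + cos ?s * sin (g q)" by (rule sin_add)
  also have "\<dots> \<le> sin ?s * 1 + 1 * sin (g q)"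
    using s0 gq tot by (intro add_mono mult_left_mono mult_right_mono sin_ge_zero) auto
  finally have "sin (?s + g q) \<le> (\<Sum>m\<in>{p..<q}. sin (g m)) + sin (g q)" using IH by simp
  then show ?case unfolding split .
qed

text \<open>
  Concavity of the sine: on \<open>[0, \<xi>]\<close> its graph lies above the chord.
\<close>

lemma sin_chord_bound:
  fixes x \<xi> :: real
  assumes "0 \<le> x" "x \<le> \<xi>" "0 < \<xi>" "\<xi> < pi"
  shows "sin \<xi> / \<xi> * x \<le> sin x"
proof -
  have "concave_on {0..pi} sin"
  proof (rule f''_le0_imp_concave[where f' = cos and f'' = "\<lambda>x. - sin x"])
    show "- sin x \<le> 0" if "x \<in> {0..pi}" for x :: real using that by (simp add: sin_ge_zero)
  qed (auto intro!: derivative_eq_intros)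
  moreover have "x = (1 - x / \<xi>) *\<^sub>R 0 + (x / \<xi>) *\<^sub>R \<xi>" using assms by simp
  ultimately have "(1 - x / \<xi>) * sin 0 + (x / \<xi>) * sin \<xi> \<le> sin x"
    using concave_onD[of "{0..pi}" sin "x / \<xi>" 0 \<xi>] assms by simp
  then show ?thesis by (simp add: mult.commute)
qed

text \<open>
  The sine is not monotone on \<open>[0, \<xi>]\<close> when \<open>\<xi> > pi / 2\<close>. The factor \<open>\<eta>\<close> makes up for it: beyond
  \<open>pi / 2\<close> one has \<open>\<eta> * sin x \<ge> \<eta> * sin \<xi> \<ge> 1\<close>.
\<close>

lemma sin_dominates:
  fixes g x \<xi> \<eta> :: real
  assumes "0 \<le> g" "g \<le> x" "x \<le> \<xi>" "\<xi> < pi" and eta: "\<eta> * sin \<xi> \<ge> 1" "\<eta> \<ge> 1"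
  shows "sin g \<le> \<eta> * sin x"
proof (cases "x \<le> pi / 2")
  case True
  then have "sin g \<le> sin x" using assms by (intro sin_monotone_2pi_le) auto
  also have "\<dots> \<le> \<eta> * sin x" using assms sin_ge_zero[of x] mult_right_mono[of 1 \<eta> "sin x"] by auto
  finally show ?thesis .
next
  case False
  then have "sin (pi - \<xi>) \<le> sin (pi - x)" using assms by (intro sin_monotone_2pi_le) auto
  then have "sin \<xi> \<le> sin x" by simp
  then have "\<eta> * sin \<xi> \<le> \<eta> * sin x" using eta by (intro mult_left_mono) auto
  then show ?thesis using eta sin_le_one[of g] by linarith
qed

text \<open>
  A delay perturbs a phase difference by some \<open>d\<close>. For an upward pull it adds at most \<open>sin r\<close>, for a
  downward pull it moreover weakens the pull by the factor \<open>cos r\<close>.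
\<close>

lemma sin_delayed:
  fixes x d r :: real
  assumes "0 \<le> x" "x \<le> pi" "\<bar>d\<bar> \<le> r" "r \<le> pi / 2"
  shows "sin (x + d) \<le> sin x + sin r" and "sin (d - x) \<le> sin r - cos r * sin x"
proof -
  have sd: "\<bar>sin d\<bar> \<le> sin r"
  proof -
    have "sin \<bar>d\<bar> \<le> sin r" using assms by (intro sin_monotone_2pi_le) auto
    moreover have "\<bar>sin d\<bar> = sin \<bar>d\<bar>"
      using assms sin_ge_zero[of "\<bar>d\<bar>"] by (cases "d \<ge> 0") auto
    ultimately show ?thesis by simp
  qed
  have cd: "cos r \<le> cos d" using assms cos_monotone_0_pi_le[of "\<bar>d\<bar>" r] by simp
  have sx: "0 \<le> sin x" using assms by (intro sin_ge_zero)
  have "\<bar>cos x * sin d\<bar> \<le> 1 * sin r"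
    unfolding abs_mult using sd by (intro mult_mono) auto
  then have cs: "cos x * sin d \<le> sin r" "cos x * sin d \<ge> - sin r" by auto
  have "sin x * cos d \<le> sin x * 1" using sx by (intro mult_left_mono) auto
  then show "sin (x + d) \<le> sin x + sin r" using cs by (simp add: sin_add)
  have "sin x * cos r \<le> sin x * cos d" using sx cd by (intro mult_left_mono) auto
  then show "sin (d - x) \<le> sin r - cos r * sin x" using cs by (simp add: sin_diff mult.commute)
qed

section \<open>Rapidly growing weights and the drift of weighted phases\<close>

text \<open>
  These are the numbers \<open>\<eta>^(m-1) (2 N)! / (2 N - m + 1)!\<close>, see \<open>geometric_weights_k_perms\<close> below. Consecutive
  ratios exceed \<open>\<eta>\<close> times twice the number \<open>N - m\<close> of oscillators above the \<open>m\<close>th one, which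
  is what the balance of pulls across the \<open>m\<close>th gap needs; all ratios are at least \<open>8\<close>.
\<close>

locale geometric_weights =
  fixes N :: nat and \<eta> :: real and w :: "nat \<Rightarrow> real"
  assumes eta2: "\<eta> \<ge> 2" and w1: "w 1 = 1"
    and ratio: "\<And>m. m \<in> {1..<N} \<Longrightarrow> w (Suc m) = \<eta> * (2 * real N + 1 - real m) * w m"
begin

lemma w_ge_1: "m \<in> {1..N} \<Longrightarrow> 1 \<le> w m"
proof (induction m)
  case (Suc m)
  show ?case
  proof (cases "m = 0")
    case False
    then have m: "m \<in> {1..<N}" using Suc.prems by auto
    have "1 * 1 * 1 \<le> \<eta> * (2 * real N + 1 - real m) * w m"
      using m eta2 Suc by (intro mult_mono) auto
    then show ?thesis using ratio[OF m] by simp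
  qed (use w1 in simp)
qed simp

lemma w_growth: "m \<in> {1..<N} \<Longrightarrow> 4 * \<eta> * w m \<le> w (Suc m)"
proof -
  assume m: "m \<in> {1..<N}"
  have "4 * \<eta> * w m = \<eta> * 4 * w m" by simp
  also have "\<dots> \<le> \<eta> * (2 * real N + 1 - real m) * w m"
    using m eta2 w_ge_1[of m] by (intro mult_right_mono mult_left_mono) auto
  finally show ?thesis using ratio[OF m] by simp
qed

lemma w_growth8: "m \<in> {1..<N} \<Longrightarrow> 8 * w m \<le> w (Suc m)"
proof -
  assume m: "m \<in> {1..<N}"
  have "8 * w m \<le> 4 * \<eta> * w m" using eta2 w_ge_1[of m] m by (intro mult_right_mono) auto
  then show ?thesis using w_growth[OF m] by linarith
qed

lemma w_partial_sum: "\<lbrakk>1 \<le> m; m \<le> N\<rbrakk> \<Longrightarrow> (\<Sum>p\<in>{1..m}. w p) \<le> 8 / 7 * w m"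
proof (induction m rule: dec_induct)
  case base then show ?case using w1 by simp
next
  case (step m)
  have "(\<Sum>p\<in>{1..Suc m}. w p) = (\<Sum>p\<in>{1..m}. w p) + w (Suc m)" using step.hyps by simp
  then show ?case using step w_growth8[of m] by auto
qed

lemma w_mono: "\<lbrakk>m \<le> n; 1 \<le> m; n \<le> N\<rbrakk> \<Longrightarrow> w m \<le> w n"
proof (induction n rule: dec_induct)
  case base then show ?case by simp
next
  case (step n)
  then show ?case using w_growth8[of n] w_ge_1[of n] by auto
qed

lemma w_strict: "\<lbrakk>1 \<le> m; m < n; n \<le> N\<rbrakk> \<Longrightarrow> w m < w n"
  using w_growth8[of m] w_ge_1[of m] w_mono[of "Suc m" n] by auto

text \<open>
  A weighted mean of sorted numbers differs from their maximum by at most \<open>1 / \<eta>\<close> times their range.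
\<close>

lemma w_top_share:
  assumes "N \<ge> 2"
  shows "(1 - 1 / \<eta>) * (\<Sum>m\<in>{1..N}. w m) \<le> w N"
proof -
  obtain n where n: "N = Suc n" "n \<ge> 1" using assms by (cases N) auto
  have split: "(\<Sum>m\<in>{1..N}. w m) = (\<Sum>m\<in>{1..n}. w m) + w N" unfolding n(1) by simp
  have "(\<Sum>m\<in>{1..n}. w m) \<le> 8 / 7 * w n" using w_partial_sum[of n] n by simp
  also have "\<dots> \<le> 4 * w n" using w_ge_1[of n] n by auto
  also have "\<dots> \<le> w N / \<eta>" using w_growth[of n] n eta2 by (simp add: field_simps)
  also have "\<dots> \<le> (\<Sum>m\<in>{1..N}. w m) / \<eta>"
  proof (intro divide_right_mono)
    have "0 \<le> w m" if "m \<in> {1..n}" for m using w_ge_1[of m] that n by simp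
    then have "0 \<le> (\<Sum>m\<in>{1..n}. w m)" by (rule sum_nonneg)
    then show "w N \<le> (\<Sum>m\<in>{1..N}. w m)" unfolding split by simp
  qed (use eta2 in simp)
  finally show ?thesis using split eta2 by (simp add: field_simps)
qed

text \<open>
  Both sides are broken up into the contributions of the gaps \<open>g m = y (m + 1) - y m\<close>. By
  subadditivity of the sine, the upward pulls across gap \<open>m\<close> amount to at most
  \<open>(N - m) * (w 1 + \<dots> + w m) * sin (g m)\<close>, and the partial sum is at most \<open>8 / 7 * w m\<close>.
  A downward pull on \<open>l\<close> from \<open>k\<close> has weight \<open>w l\<close>, which is at least
  \<open>7 / 8 * (w (k + 1) + \<dots> + w l)\<close>; so gap \<open>m\<close> between them may claim the share \<open>7 / 8 * w (m + 1)\<close> of it.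
  Since each gap is spanned by an arc and \<open>w (m + 1)\<close> contains the factor \<open>\<eta> * (2 * (N - m) + 1)\<close>, this
  share pays for the upward pulls and leaves at least the chord bound \<open>sin \<xi> / \<xi> * C * g m\<close>.
\<close>

lemma sorted_drift:
  fixes y :: "nat \<Rightarrow> real" and A :: "nat \<Rightarrow> nat \<Rightarrow> real" and C \<xi> :: real
  assumes N1: "N \<ge> 1"
    and mono: "\<And>m n. \<lbrakk>1 \<le> m; m \<le> n; n \<le> N\<rbrakk> \<Longrightarrow> y m \<le> y n"
    and spread: "y N - y 1 \<le> \<xi>" and xi: "0 < \<xi>" "\<xi> < pi" and eta: "\<eta> * sin \<xi> \<ge> 1"
    and A01: "\<And>p q. 0 \<le> A p q \<and> A p q \<le> 1"
    and cross: "\<And>m. m \<in> {1..<N} \<Longrightarrow> \<exists>l\<in>{m<..N}. \<exists>k\<in>{1..m}. A l k = 1"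
    and C: "7 / 8 \<le> C"
  shows "(\<Sum>p\<in>{1..N}. w p * (\<Sum>q\<in>{1..N}. A p q *
            (if p < q then sin (y q - y p) else - C * sin (y p - y q))))
         \<le> - (sin \<xi> / \<xi> * C * (y N - y 1))"
proof -
  define g where "g m = y (Suc m) - y m" for m
  let ?V = "{1..N}" and ?G = "{1..<N}"
  have y_diff: "y q - y p = (\<Sum>m\<in>{p..<q}. g m)" if "p \<le> q" for p q
    unfolding g_def using that by (simp add: sum_Suc_diff')
  have g0: "0 \<le> g m" if "m \<in> ?G" for m using mono[of m "Suc m"] that by (simp add: g_def)
  have dist: "0 \<le> y q - y p" "y q - y p \<le> \<xi>" if "1 \<le> p" "p \<le> q" "q \<le> N" for p q
    using mono[of p q] mono[of 1 p] mono[of q N] that spread by auto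
  have sg0: "0 \<le> sin (g m)" if "m \<in> ?G" for m
    using dist[of m "Suc m"] that xi unfolding g_def by (intro sin_ge_zero) auto
  have w0: "0 \<le> w p" if "p \<in> ?V" for p using w_ge_1[OF that] by simp
  define up where "up = (\<Sum>p\<in>?V. \<Sum>q\<in>?V. w p * (A p q * (if p < q then sin (y q - y p) else 0)))"
  define dn where "dn = (\<Sum>p\<in>?V. \<Sum>q\<in>?V. w p * (A p q * (if q < p then sin (y p - y q) else 0)))"
  have total: "(\<Sum>p\<in>?V. w p * (\<Sum>q\<in>?V. A p q *
      (if p < q then sin (y q - y p) else - C * sin (y p - y q)))) = up - C * dn"
    unfolding up_def dn_def sum_distrib_left sum_subtractf[symmetric]
    by (intro sum.cong refl) auto
  \<comment> \<open>The upward pull across an interval is charged to the gaps inside it.\<close>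
  have "up \<le> (\<Sum>p\<in>?V. \<Sum>q\<in>?V. \<Sum>m\<in>?G. if p \<le> m \<and> m < q then w p * sin (g m) else 0)"
    unfolding up_def
  proof (intro sum_mono)
    fix p q assume p: "p \<in> ?V" and q: "q \<in> ?V"
    show "w p * (A p q * (if p < q then sin (y q - y p) else 0))
        \<le> (\<Sum>m\<in>?G. if p \<le> m \<and> m < q then w p * sin (g m) else 0)"
    proof (cases "p < q")
      case True
      have eq: "{m \<in> ?G. p \<le> m \<and> m < q} = {p..<q}" using p q by auto
      have "sin (y q - y p) \<le> (\<Sum>m\<in>{p..<q}. sin (g m))"
        unfolding y_diff[OF less_imp_le[OF True]]
      proof (rule sin_subadditive_sum)
        show "(\<Sum>m\<in>{p..<q}. g m) \<le> pi"
          using dist[of p q] p q True xi y_diff[of p q] by auto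
        show "0 \<le> g m" if "m \<in> {p..<q}" for m using that p q by (intro g0) auto
      qed (use True in simp)
      moreover have "A p q * sin (y q - y p) \<le> 1 * sin (y q - y p)"
        using A01[of p q] dist[of p q] p q True xi by (intro mult_right_mono sin_ge_zero) auto
      ultimately have "A p q * sin (y q - y p) \<le> (\<Sum>m\<in>{p..<q}. sin (g m))" by simp
      then have "w p * (A p q * sin (y q - y p)) \<le> w p * (\<Sum>m\<in>{p..<q}. sin (g m))"
        by (intro mult_left_mono w0 p)
      also have "\<dots> = (\<Sum>m\<in>{m \<in> ?G. p \<le> m \<and> m < q}. w p * sin (g m))"
        unfolding eq by (rule sum_distrib_left)
      also have "\<dots> = (\<Sum>m\<in>?G. if p \<le> m \<and> m < q then w p * sin (g m) else 0)"
        by (rule sum.inter_filter) simp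
      finally show ?thesis using True by simp
    next
      case False
      then show ?thesis using w0[OF p] sg0 by (auto intro!: sum_nonneg)
    qed
  qed
  also have "\<dots> = (\<Sum>p\<in>?V. \<Sum>m\<in>?G. \<Sum>q\<in>?V. if p \<le> m \<and> m < q then w p * sin (g m) else 0)"
    by (intro sum.cong refl sum.swap)
  also have "\<dots> = (\<Sum>m\<in>?G. \<Sum>p\<in>?V. \<Sum>q\<in>?V. if p \<le> m \<and> m < q then w p * sin (g m) else 0)"
    by (rule sum.swap)
  also have "\<dots> = (\<Sum>m\<in>?G. (real N - real m) * (\<Sum>p\<in>{1..m}. w p) * sin (g m))"
  proof (intro sum.cong refl)
    fix m assume m: "m \<in> ?G"
    have "(\<Sum>q\<in>?V. if p \<le> m \<and> m < q then w p * sin (g m) else 0)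
        = (if p \<le> m then (real N - real m) * (w p * sin (g m)) else 0)" for p
    proof (cases "p \<le> m")
      case True
      have "{q \<in> ?V. m < q} = {m<..N}" using m by auto
      then show ?thesis using True m
        by (simp add: sum.inter_filter[symmetric] of_nat_diff)
    qed simp
    then have "(\<Sum>p\<in>?V. \<Sum>q\<in>?V. if p \<le> m \<and> m < q then w p * sin (g m) else 0)
        = (\<Sum>p\<in>{p \<in> ?V. p \<le> m}. (real N - real m) * (w p * sin (g m)))"
      by (simp only: sum.inter_filter[symmetric] finite_atLeastAtMost)
    also have "{p \<in> ?V. p \<le> m} = {1..m}" using m by auto
    finally show "(\<Sum>p\<in>?V. \<Sum>q\<in>?V. if p \<le> m \<and> m < q then w p * sin (g m) else 0)
        = (real N - real m) * (\<Sum>p\<in>{1..m}. w p) * sin (g m)"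
      by (simp add: sum_distrib_left sum_distrib_right mult.assoc)
  qed
  also have "\<dots> \<le> (\<Sum>m\<in>?G. (real N - real m) * (8 / 7 * w m) * sin (g m))"
    using w_partial_sum sg0 by (intro sum_mono mult_right_mono mult_left_mono) auto
  finally have up_le: "up \<le> (\<Sum>m\<in>?G. (real N - real m) * (8 / 7 * w m) * sin (g m))" .
  have pull_exists: "\<exists>X. g m \<le> X \<and> X \<le> \<xi> \<and> sin X \<le>
      (\<Sum>p\<in>?V. \<Sum>q\<in>?V. if q \<le> m \<and> m < p then A p q * sin (y p - y q) else 0)" if m: "m \<in> ?G" for m
  proof -
    obtain l k where lk: "l \<in> {m<..N}" "k \<in> {1..m}" "A l k = 1" using cross[OF m] by blast
    let ?f = "\<lambda>p q. if q \<le> m \<and> m < p then A p q * sin (y p - y q) else 0"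
    have f0: "0 \<le> ?f p q" if "p \<in> ?V" "q \<in> ?V" for p q
      using that A01[of p q] dist[of q p] xi by (auto intro!: mult_nonneg_nonneg sin_ge_zero)
    have "sin (y l - y k) = ?f l k" using lk by simp
    also have "\<dots> \<le> (\<Sum>q\<in>?V. ?f l q)"
      using lk m f0[of l] by (intro member_le_sum) auto
    also have "\<dots> \<le> (\<Sum>p\<in>?V. \<Sum>q\<in>?V. ?f p q)"
      using lk m f0 by (intro member_le_sum[where f = "\<lambda>p. \<Sum>q\<in>?V. ?f p q"] sum_nonneg) auto
    finally have "sin (y l - y k) \<le> (\<Sum>p\<in>?V. \<Sum>q\<in>?V. ?f p q)" .
    moreover have "g m \<le> y l - y k"
      using mono[of "Suc m" l] mono[of k m] lk by (auto simp: g_def)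
    moreover have "y l - y k \<le> \<xi>" using dist[of k l] lk m by auto
    ultimately show ?thesis by blast
  qed
  \<comment> \<open>The downward pull on the upper end of an arc is shared among the gaps that it spans.\<close>
  have "(\<Sum>m\<in>?G. 7 / 8 * w (Suc m) *
      (\<Sum>p\<in>?V. \<Sum>q\<in>?V. if q \<le> m \<and> m < p then A p q * sin (y p - y q) else 0))
    = (\<Sum>m\<in>?G. \<Sum>p\<in>?V. \<Sum>q\<in>?V.
        if q \<le> m \<and> m < p then 7 / 8 * w (Suc m) * (A p q * sin (y p - y q)) else 0)"
    by (simp add: sum_distrib_left if_distrib cong: if_cong)
  also have "\<dots> = (\<Sum>p\<in>?V. \<Sum>m\<in>?G. \<Sum>q\<in>?V.
        if q \<le> m \<and> m < p then 7 / 8 * w (Suc m) * (A p q * sin (y p - y q)) else 0)"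
    by (rule sum.swap)
  also have "\<dots> = (\<Sum>p\<in>?V. \<Sum>q\<in>?V. \<Sum>m\<in>?G.
        if q \<le> m \<and> m < p then 7 / 8 * w (Suc m) * (A p q * sin (y p - y q)) else 0)"
    by (intro sum.cong refl sum.swap)
  also have "\<dots> \<le> dn"
    unfolding dn_def
  proof (intro sum_mono)
    fix p q assume p: "p \<in> ?V" and q: "q \<in> ?V"
    show "(\<Sum>m\<in>?G. if q \<le> m \<and> m < p then 7 / 8 * w (Suc m) * (A p q * sin (y p - y q)) else 0)
        \<le> w p * (A p q * (if q < p then sin (y p - y q) else 0))"
    proof (cases "q < p")
      case True
      have eq: "{m \<in> ?G. q \<le> m \<and> m < p} = {q..<p}" using p q by auto
      have "(\<Sum>m\<in>{q..<p}. w (Suc m)) = (\<Sum>m\<in>{Suc q..<Suc p}. w m)"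
        by (rule sum.shift_bounds_Suc_ivl[symmetric])
      also have "\<dots> \<le> (\<Sum>m\<in>{1..p}. w m)"
        using p q by (intro sum_mono2) (auto intro!: w0)
      also have "\<dots> \<le> 8 / 7 * w p" using w_partial_sum[of p] p by simp
      finally have ws: "7 / 8 * (\<Sum>m\<in>{q..<p}. w (Suc m)) \<le> w p" by simp
      have "(\<Sum>m\<in>?G. if q \<le> m \<and> m < p then 7 / 8 * w (Suc m) * (A p q * sin (y p - y q)) else 0)
          = (\<Sum>m\<in>{q..<p}. 7 / 8 * w (Suc m) * (A p q * sin (y p - y q)))"
        unfolding eq[symmetric] by (rule sum.inter_filter[symmetric]) simp
      also have "\<dots> = 7 / 8 * (\<Sum>m\<in>{q..<p}. w (Suc m)) * (A p q * sin (y p - y q))"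
        by (simp add: sum_distrib_left sum_distrib_right)
      also have "\<dots> \<le> w p * (A p q * sin (y p - y q))"
        using A01[of p q] dist[of q p] p q True xi
        by (intro mult_right_mono ws mult_nonneg_nonneg sin_ge_zero) auto
      finally show ?thesis using True by simp
    next
      case False
      then have "(\<Sum>m\<in>?G. if q \<le> m \<and> m < p then 7 / 8 * w (Suc m) * (A p q * sin (y p - y q)) else 0) = 0"
        by (intro sum.neutral) auto
      then show ?thesis using False by simp
    qed
  qed
  finally have dn_ge: "(\<Sum>m\<in>?G. 7 / 8 * w (Suc m) *
      (\<Sum>p\<in>?V. \<Sum>q\<in>?V. if q \<le> m \<and> m < p then A p q * sin (y p - y q) else 0)) \<le> dn" .
  have gap: "(real N - real m) * (8 / 7 * w m) * sin (g m) + sin \<xi> / \<xi> * C * g m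
      \<le> C * (7 / 8 * w (Suc m) *
      (\<Sum>p\<in>?V. \<Sum>q\<in>?V. if q \<le> m \<and> m < p then A p q * sin (y p - y q) else 0))"
    if m: "m \<in> ?G" for m
  proof -
    obtain X where X: "g m \<le> X" "X \<le> \<xi>" "sin X \<le>
      (\<Sum>p\<in>?V. \<Sum>q\<in>?V. if q \<le> m \<and> m < p then A p q * sin (y p - y q) else 0)"
      using pull_exists[OF m] by blast
    have X0: "0 \<le> X" using g0[OF m] X by simp
    have sX: "0 \<le> sin X" using X X0 xi by (intro sin_ge_zero) auto
    have lam: "sin \<xi> / \<xi> * g m \<le> sin X"
    proof -
      have "sin \<xi> / \<xi> * g m \<le> sin \<xi> / \<xi> * X"
        using X xi sin_ge_zero[of \<xi>] by (intro mult_left_mono) auto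
      then show ?thesis using sin_chord_bound[of X \<xi>] X X0 xi by simp
    qed
    have dom: "sin (g m) \<le> \<eta> * sin X" using g0[OF m] X xi eta eta2 by (intro sin_dominates) auto
    have wm: "1 \<le> w m" using w_ge_1[of m] m by simp
    define d where "d = real N - real m"
    have d1: "1 \<le> d" using m by (simp add: d_def)
    define Z where "Z = w m * (\<eta> * sin X)"
    have Z1: "sin X \<le> Z"
      unfolding Z_def using wm eta2 sX mult_mono[of 1 "w m" "sin X" "\<eta> * sin X"]
        mult_right_mono[of 1 \<eta> "sin X"] by simp
    have Z0: "0 \<le> Z" using Z1 sX by simp
    have "d * (8 / 7 * w m) * sin (g m) \<le> d * (8 / 7 * w m) * (\<eta> * sin X)"
      using dom d1 wm by (intro mult_left_mono) auto
    also have "\<dots> = 8 / 7 * d * Z" by (simp add: Z_def)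
    finally have c1: "d * (8 / 7 * w m) * sin (g m) \<le> 8 / 7 * d * Z" .
    have c2: "sin \<xi> / \<xi> * C * g m \<le> C * Z"
      using mult_left_mono[OF order_trans[OF lam Z1], of C] C by (simp add: mult_ac)
    have "8 / 7 * d * Z + C * Z \<le> C * (7 / 8 * ((2 * d + 1) * Z))"
    proof -
      have "8 / 7 * d + C \<le> C * (7 / 8 * (2 * d + 1))"
      proof -
        have "C * (7 / 8 * (2 * d + 1)) - C = C * (7 / 4 * d - 1 / 8)" by (simp add: algebra_simps)
        also have "\<dots> \<ge> 7 / 8 * (7 / 4 * d - 1 / 8)" using C d1 by (intro mult_right_mono) auto
        moreover have "7 / 8 * (7 / 4 * d - 1 / 8) \<ge> 8 / 7 * d" using d1 by (simp add: field_simps)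
        ultimately show ?thesis by linarith
      qed
      from mult_right_mono[OF this Z0] show ?thesis by (simp add: algebra_simps)
    qed
    also have "\<dots> \<le> C * (7 / 8 * (w (Suc m) * sin X))"
    proof -
      have "w (Suc m) * sin X = (2 * real N + 1 - real m) * Z"
        unfolding ratio[OF m] Z_def by (simp add: mult_ac)
      moreover have "(2 * d + 1) * Z \<le> (2 * real N + 1 - real m) * Z"
        using Z0 by (intro mult_right_mono) (auto simp: d_def)
      ultimately show ?thesis using C by (intro mult_left_mono) auto
    qed
    also have "\<dots> \<le> C * (7 / 8 * (w (Suc m) *
      (\<Sum>p\<in>?V. \<Sum>q\<in>?V. if q \<le> m \<and> m < p then A p q * sin (y p - y q) else 0)))"
      using X(3) C w_ge_1[of "Suc m"] m by (intro mult_left_mono) auto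
    finally have "8 / 7 * d * Z + C * Z \<le> C * (7 / 8 * (w (Suc m) *
      (\<Sum>p\<in>?V. \<Sum>q\<in>?V. if q \<le> m \<and> m < p then A p q * sin (y p - y q) else 0)))" .
    with c1 c2 have "d * (8 / 7 * w m) * sin (g m) + sin \<xi> / \<xi> * C * g m \<le> C * (7 / 8 * (w (Suc m) *
      (\<Sum>p\<in>?V. \<Sum>q\<in>?V. if q \<le> m \<and> m < p then A p q * sin (y p - y q) else 0)))" by linarith
    then show ?thesis unfolding d_def by (simp only: mult.assoc)
  qed
  have "(\<Sum>m\<in>?G. (real N - real m) * (8 / 7 * w m) * sin (g m)) + sin \<xi> / \<xi> * C * (\<Sum>m\<in>?G. g m)
      \<le> (\<Sum>m\<in>?G. C * (7 / 8 * w (Suc m) *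
      (\<Sum>p\<in>?V. \<Sum>q\<in>?V. if q \<le> m \<and> m < p then A p q * sin (y p - y q) else 0)))"
    unfolding sum_distrib_left[of "sin \<xi> / \<xi> * C"] sum.distrib[symmetric]
    by (intro sum_mono gap)
  also have "\<dots> \<le> C * dn"
    unfolding sum_distrib_left[symmetric] using C by (intro mult_left_mono dn_ge) auto
  finally show ?thesis using up_le y_diff[OF N1] unfolding total by simp
qed

definition weighted :: "(nat \<Rightarrow> real) \<Rightarrow> real" where
  "weighted y = (\<Sum>m\<in>{1..N}. w m * y m)"

text \<open>
  The rearrangement inequality: swapping two positions in the wrong order would increase the
  weighted sum, as the weights are strictly increasing.
\<close>

lemma maximising_permutation_sorts:
  assumes p: "p permutes {1..N}"
    and max: "\<And>p'. p' permutes {1..N} \<Longrightarrow> weighted (x \<circ> p') \<le> weighted (x \<circ> p)"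
    and mn: "1 \<le> m" "m \<le> n" "n \<le> N"
  shows "x (p m) \<le> x (p n)"
proof (rule ccontr)
  assume c: "\<not> x (p m) \<le> x (p n)"
  then have lt: "m < n" using mn by (cases "m = n") auto
  let ?t = "Transposition.transpose m n"
  have pt: "(p \<circ> ?t) permutes {1..N}"
    using p mn by (intro permutes_compose[OF permutes_swap_id]) auto
  let ?R = "{1..N} - {m} - {n}"
  have split: "weighted y = w m * y m + w n * y n + (\<Sum>k\<in>?R. w k * y k)" for y
    unfolding weighted_def using mn lt
    by (subst sum.remove[of _ m]; simp) (subst sum.remove[of _ n]; simp)
  have "(\<Sum>k\<in>?R. w k * (x \<circ> (p \<circ> ?t)) k) = (\<Sum>k\<in>?R. w k * (x \<circ> p) k)"
    by (intro sum.cong) (auto simp: Transposition.transpose_def)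
  then have "weighted (x \<circ> (p \<circ> ?t)) - weighted (x \<circ> p) = (w n - w m) * (x (p m) - x (p n))"
    unfolding split by (simp add: algebra_simps)
  also have "\<dots> > 0" using w_strict[of m n] mn lt c by simp
  finally show False using max[OF pt] by simp
qed

text \<open>
  The sorted estimate in terms of the original labels. The gap below position \<open>m + 1\<close> is spanned by
  an arc because the set of vertices above it has an arc leaving it. The perturbations contribute
  at most \<open>sin r\<close> for each of the \<open>N - 1\<close> other vertices.
\<close>

lemma drift_of_maximiser:
  fixes x :: "nat \<Rightarrow> real" and A e :: "nat \<Rightarrow> nat \<Rightarrow> real"
  assumes N1: "N \<ge> 1" and p: "p permutes {1..N}"
    and max: "\<And>p'. p' permutes {1..N} \<Longrightarrow> weighted (x \<circ> p') \<le> weighted (x \<circ> p)"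
    and spread: "\<And>i j. \<lbrakk>i \<in> {1..N}; j \<in> {1..N}\<rbrakk> \<Longrightarrow> x i - x j \<le> \<xi>"
    and xi: "0 < \<xi>" "\<xi> < pi" and eta: "\<eta> * sin \<xi> \<ge> 1"
    and A01: "\<And>i j. 0 \<le> A i j \<and> A i j \<le> 1" and Aii: "\<And>i. A i i = 0"
    and cross: "\<And>S. \<lbrakk>S \<subseteq> {1..N}; S \<noteq> {}; S \<noteq> {1..N}\<rbrakk> \<Longrightarrow> \<exists>i\<in>S. \<exists>j\<in>{1..N} - S. A i j = 1"
    and e: "\<And>i j. \<lbrakk>i \<in> {1..N}; j \<in> {1..N}\<rbrakk> \<Longrightarrow> \<bar>e i j\<bar> \<le> r"
    and r: "0 \<le> r" "r \<le> pi / 2" "7 / 8 \<le> cos r"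
  shows "(\<Sum>m\<in>{1..N}. w m * (\<Sum>j\<in>{1..N}. A (p m) j * sin (x j + e (p m) j - x (p m))))
      \<le> (\<Sum>m\<in>{1..N}. w m) * ((real N - 1) * sin r) - sin \<xi> / \<xi> * cos r * (x (p N) - x (p 1))"
proof -
  let ?V = "{1..N}"
  define y where "y = x \<circ> p"
  define B where "B m n = A (p m) (p n)" for m n
  have pV: "p m \<in> ?V" if "m \<in> ?V" for m using p that by (metis permutes_in_image)
  have mono: "y m \<le> y n" if "1 \<le> m" "m \<le> n" "n \<le> N" for m n
    using maximising_permutation_sorts[OF p max that] by (simp add: y_def)
  have sr: "0 \<le> sin r" using r by (intro sin_ge_zero) auto
  have inner: "(\<Sum>j\<in>?V. A (p m) j * sin (x j + e (p m) j - x (p m)))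
      \<le> (real N - 1) * sin r +
        (\<Sum>n\<in>?V. B m n * (if m < n then sin (y n - y m) else - cos r * sin (y m - y n)))"
    if m: "m \<in> ?V" for m
  proof -
    have "(\<Sum>j\<in>?V. A (p m) j * sin (x j + e (p m) j - x (p m)))
        = (\<Sum>n\<in>?V. A (p m) (p n) * sin (x (p n) + e (p m) (p n) - x (p m)))"
      using sum.permute[OF p, of "\<lambda>j. A (p m) j * sin (x j + e (p m) j - x (p m))"] by simp
    also have "\<dots> \<le> (\<Sum>n\<in>?V. (if n = m then 0 else sin r) +
        B m n * (if m < n then sin (y n - y m) else - cos r * sin (y m - y n)))"
    proof (rule sum_mono)
      fix n assume n: "n \<in> ?V"
      have en: "\<bar>e (p m) (p n)\<bar> \<le> r" using e pV m n by blast
      have d: "y a - y b \<le> pi" if "a \<in> ?V" "b \<in> ?V" for a b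
        using spread[OF pV[OF that(1)] pV[OF that(2)]] xi by (simp add: y_def)
      have s: "sin (y n + e (p m) (p n) - y m)
          \<le> sin r + (if m < n then sin (y n - y m) else - cos r * sin (y m - y n))"
      proof (cases "m < n")
        case True
        then have "0 \<le> y n - y m" using mono[of m n] m n by simp
        from sin_delayed(1)[OF this d[OF n m] en r(2)] True show ?thesis
          by (simp add: algebra_simps)
      next
        case False
        then have "0 \<le> y m - y n" using mono[of n m] m n by simp
        from sin_delayed(2)[OF this d[OF m n] en r(2)] False show ?thesis
          by (simp add: algebra_simps)
      qed
      have "B m n * sin (y n + e (p m) (p n) - y m)
          \<le> B m n * sin r + B m n * (if m < n then sin (y n - y m) else - cos r * sin (y m - y n))"
        using mult_left_mono[OF s, of "B m n"] A01 by (simp add: B_def distrib_left)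
      moreover have "B m n * sin r \<le> (if n = m then 0 else sin r)"
        using A01[of "p m" "p n"] Aii sr mult_right_mono[of "B m n" 1 "sin r"] by (auto simp: B_def)
      ultimately show "A (p m) (p n) * sin (x (p n) + e (p m) (p n) - x (p m))
          \<le> (if n = m then 0 else sin r) +
            B m n * (if m < n then sin (y n - y m) else - cos r * sin (y m - y n))"
        by (simp add: B_def y_def)
    qed
    also have "(\<Sum>n\<in>?V. (if n = m then 0 else sin r)) = (real N - 1) * sin r"
      using m by (subst sum.remove[of _ m]) (auto simp: of_nat_diff)
    then have "(\<Sum>n\<in>?V. (if n = m then 0 else sin r) +
        B m n * (if m < n then sin (y n - y m) else - cos r * sin (y m - y n)))
      = (real N - 1) * sin r +
        (\<Sum>n\<in>?V. B m n * (if m < n then sin (y n - y m) else - cos r * sin (y m - y n)))"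
      by (simp add: sum.distrib)
    finally show ?thesis .
  qed
  have "(\<Sum>m\<in>?V. w m * (\<Sum>j\<in>?V. A (p m) j * sin (x j + e (p m) j - x (p m))))
      \<le> (\<Sum>m\<in>?V. w m * ((real N - 1) * sin r +
        (\<Sum>n\<in>?V. B m n * (if m < n then sin (y n - y m) else - cos r * sin (y m - y n)))))"
    using w_ge_1 by (intro sum_mono mult_left_mono inner) (auto intro: order_trans[OF zero_le_one])
  also have "\<dots> = (\<Sum>m\<in>?V. w m) * ((real N - 1) * sin r) +
      (\<Sum>m\<in>?V. w m * (\<Sum>n\<in>?V. B m n * (if m < n then sin (y n - y m) else - cos r * sin (y m - y n))))"
    by (simp add: distrib_left sum.distrib sum_distrib_right)
  also have "(\<Sum>m\<in>?V. w m * (\<Sum>n\<in>?V. B m n *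
      (if m < n then sin (y n - y m) else - cos r * sin (y m - y n))))
    \<le> - (sin \<xi> / \<xi> * cos r * (y N - y 1))"
  proof (rule sorted_drift[OF N1 mono _ xi eta])
    show "y N - y 1 \<le> \<xi>" using spread[OF pV pV] N1 by (simp add: y_def)
    show "0 \<le> B m n \<and> B m n \<le> 1" for m n using A01 by (simp add: B_def)
    show "7 / 8 \<le> cos r" by fact
    fix m assume m: "m \<in> {1..<N}"
    let ?S = "p ` {m<..N}"
    have "inj p" using p by (rule permutes_inj)
    then have notin: "p k \<notin> ?S" if "k \<le> m" for k using that by (simp add: inj_image_mem_iff)
    have "p m \<notin> ?S" "p m \<in> ?V" using notin m pV by auto
    then have "?S \<noteq> ?V" by blast
    moreover have "?S \<noteq> {}" using m by auto
    moreover have "?S \<subseteq> ?V" using pV by auto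
    ultimately have "\<exists>i\<in>?S. \<exists>j\<in>?V - ?S. A i j = 1" by (intro cross)
    then obtain i j where ij: "i \<in> ?S" "j \<in> ?V" "j \<notin> ?S" "A i j = 1" by (elim bexE DiffE)
    obtain l where l: "l \<in> {m<..N}" "i = p l" using ij(1) by (elim imageE)
    obtain k where k: "k \<in> ?V" "j = p k" using ij(2) permutes_image[OF p] by (metis imageE)
    have "k \<le> m" using ij(3) k by (cases "k \<le> m") auto
    then show "\<exists>l\<in>{m<..N}. \<exists>k\<in>{1..m}. B l k = 1"
      using l k ij(4) by (intro bexI[of _ l] bexI[of _ k]) (auto simp: B_def)
  qed
  finally show ?thesis by (simp add: y_def)
qed

end
lemma k_perms_0: "k_perms m 0 = 1"
  by (simp add: k_perms_def)

lemma k_perms_Suc: "k < m \<Longrightarrow> k_perms m (Suc k) = (real m - real k) * k_perms m k"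
proof -
  assume "k < m"
  then obtain d where "m = Suc (k + d)" using less_iff_Suc_add by auto
  then show ?thesis by (simp add: k_perms_def)
qed

lemma geometric_weights_k_perms:
  assumes "\<eta> \<ge> 2"
  shows "geometric_weights N \<eta> (\<lambda>m. \<eta> ^ (m - 1) * k_perms (2 * N) (m - 1))"
proof
  show "\<eta> ^ (1 - 1) * k_perms (2 * N) (1 - 1) = 1" by (simp add: k_perms_0)
  fix m assume m: "m \<in> {1..<N}"
  then obtain k where k: "m = Suc k" by (cases m) auto
  then show "\<eta> ^ (Suc m - 1) * k_perms (2 * N) (Suc m - 1)
      = \<eta> * (2 * real N + 1 - real m) * (\<eta> ^ (m - 1) * k_perms (2 * N) (m - 1))"
    using m by (simp add: k_perms_Suc)
qed (use assms in simp)

text \<open>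
  The total weight is the sum that occurs in the constant \<open>c\<close> of the theorem.
\<close>

lemma sum_k_perms_weights:
  assumes "N \<ge> 1"
  shows "(\<Sum>m\<in>{1..N}. \<eta> ^ (m - 1) * k_perms (2 * N) (m - 1)) = (\<Sum>j=1..N - 1. \<eta> ^ j * k_perms (2 * N) j) + 1"
proof -
  obtain n where n: "N = Suc n" using assms by (cases N) auto
  have "(\<Sum>m\<in>{1..N}. \<eta> ^ (m - 1) * k_perms (2 * N) (m - 1)) = (\<Sum>j\<in>{0..n}. \<eta> ^ j * k_perms (2 * N) j)"
    unfolding n One_nat_def sum.shift_bounds_cl_Suc_ivl by simp
  also have "\<dots> = (\<Sum>j\<in>{1..n}. \<eta> ^ j * k_perms (2 * N) j) + 1"
    by (simp add: sum.atLeast_Suc_atMost k_perms_0)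
  finally show ?thesis using n by simp
qed

section \<open>Cohesion and synchronisation of delayed oscillators\<close>

text \<open>
  Here \<open>A\<close> is the adjacency matrix, \<open>\<delta>\<close> bounds the differences of natural frequencies and \<open>D0\<close> the
  initial phase differences. The condition \<open>strong\<close> compares the disorder \<open>\<delta> + 2 \<kappa> sin (R T)\<close>
  with the decay rate of the Lyapunov function, evaluated at the level \<open>(1 - 2 / \<eta>) * dinf\<close>.
\<close>

locale delayed_kuramoto = geometric_weights +
  fixes A :: "nat \<Rightarrow> nat \<Rightarrow> real" and \<Omega> :: "nat \<Rightarrow> real" and \<kappa> :: real
    and \<tau> :: "nat \<Rightarrow> nat \<Rightarrow> real" and T :: real and \<theta> :: "nat \<Rightarrow> real \<Rightarrow> real"
    and R \<delta> D0 \<zeta> \<xi> dinf :: real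
  assumes N2: "N \<ge> 2" and kappa: "\<kappa> > 0"
    and delays: "\<And>i j. \<lbrakk>i \<in> {1..N}; j \<in> {1..N}\<rbrakk> \<Longrightarrow> 0 \<le> \<tau> i j \<and> \<tau> i j \<le> T" and T0: "T > 0"
    and phase_cont: "\<And>i. i \<in> {1..N} \<Longrightarrow> continuous_on {0..} (\<theta> i)"
    and phase_ode: "\<And>i t. \<lbrakk>i \<in> {1..N}; t > 0\<rbrakk> \<Longrightarrow> (\<theta> i has_real_derivative
        \<Omega> i + \<kappa> / (real N - 1) * (\<Sum>j\<in>{1..N}. A i j * sin (\<theta> j (t - \<tau> i j) - \<theta> i t))) (at t)"
    and A_cases: "\<And>i j. A i j = 0 \<or> A i j = 1" and A_irrefl: "\<And>i. A i i = 0"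
    and A_conn: "\<And>i j. \<lbrakk>i \<in> {1..N}; j \<in> {1..N}\<rbrakk> \<Longrightarrow>
        (i, j) \<in> {(i, j). i \<in> {1..N} \<and> j \<in> {1..N} \<and> A i j = 1}\<^sup>*"
    and speed: "\<And>i. i \<in> {1..N} \<Longrightarrow> \<bar>\<Omega> i\<bar> + \<kappa> \<le> R"
    and freq_spread: "\<And>i j. \<lbrakk>i \<in> {1..N}; j \<in> {1..N}\<rbrakk> \<Longrightarrow> \<Omega> i - \<Omega> j \<le> \<delta>"
    and initial: "\<And>i j. \<lbrakk>i \<in> {1..N}; j \<in> {1..N}\<rbrakk> \<Longrightarrow> \<theta> i 0 - \<theta> j 0 \<le> D0"
    and room: "D0 + 2 * (R * T) < \<zeta>" and dinf: "0 < dinf" "dinf < \<zeta>"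
    and xi: "\<xi> < pi" and eta_xi: "\<eta> * sin \<xi> \<ge> 1" and eta_gt2: "\<eta> > 2"
    and zeta: "\<zeta> < (1 - 2 / \<eta>) * \<xi>"
    and lag: "R * T \<le> 1 / 2" "dinf + R * T < pi / 2"
    and strong: "\<delta> + 2 * \<kappa> * sin (R * T) <
        2 * \<kappa> * (sin \<xi> / \<xi>) * cos (R * T) / ((real N - 1) * (\<Sum>m\<in>{1..N}. w m)) * ((1 - 2 / \<eta>) * dinf)"
begin

abbreviation V where "V \<equiv> {1..N}"

definition velocity :: "nat \<Rightarrow> real \<Rightarrow> real" where
  "velocity i t = \<Omega> i + \<kappa> / (real N - 1) * (\<Sum>j\<in>V. A i j * sin (\<theta> j (t - \<tau> i j) - \<theta> i t))"

lemma phase_deriv: "\<lbrakk>i \<in> V; t > 0\<rbrakk> \<Longrightarrow> (\<theta> i has_real_derivative velocity i t) (at t)"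
  unfolding velocity_def by (rule phase_ode)

lemma A01: "0 \<le> A i j \<and> A i j \<le> 1"
  using A_cases[of i j] by auto

lemma beta_pos: "1 - 2 / \<eta> > 0"
  using eta_gt2 by simp

lemma zeta_pos: "\<zeta> > 0"
  using dinf by simp

lemma xi_pos: "\<xi> > 0"
  using zeta zeta_pos beta_pos by (metis less_trans zero_less_mult_pos)

lemma R_pos: "R > 0"
  using speed[of 1] N2 kappa by auto

lemma RT_pos: "R * T > 0"
  using R_pos T0 by simp

lemma cos_RT: "7 / 8 \<le> cos (R * T)"
proof -
  have "cos (1 / 2) \<le> cos (R * T)"
    using lag RT_pos pi_gt3 by (intro cos_monotone_0_pi_le) auto
  moreover have "7 / 8 \<le> cos (1 / 2 :: real)"
  proof -
    have "\<bar>sin (1 / 4 :: real)\<bar> \<le> 1 / 4" using abs_sin_x_le_abs_x[of "1 / 4 :: real"] by simp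
    then have "(sin (1 / 4 :: real))\<^sup>2 \<le> (1 / 4)\<^sup>2" by (subst abs_le_square_iff[symmetric]) simp
    moreover have "cos (1 / 2 :: real) = 1 - 2 * (sin (1 / 4))\<^sup>2"
      using cos_double_sin[of "1 / 4 :: real"] by simp
    ultimately show ?thesis by (simp add: power2_eq_square)
  qed
  ultimately show ?thesis by simp
qed

text \<open>
  There are at most \<open>N - 1\<close> summands because \<open>A i i = 0\<close>.
\<close>

lemma row_sum_le:
  assumes "i \<in> V" and "\<And>j. j \<in> V \<Longrightarrow> \<bar>f j\<bar> \<le> 1"
  shows "\<bar>\<Sum>j\<in>V. A i j * f j\<bar> \<le> real N - 1"
proof -
  have "\<bar>\<Sum>j\<in>V. A i j * f j\<bar> \<le> (\<Sum>j\<in>V. if j = i then 0 else 1)"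
  proof (rule order_trans[OF sum_abs sum_mono])
    fix j assume "j \<in> V"
    then show "\<bar>A i j * f j\<bar> \<le> (if j = i then 0 else 1)"
      using assms(2)[of j] A_irrefl[of i] A_cases[of i j] by (auto simp: abs_mult)
  qed
  also have "\<dots> = real N - 1" using assms by (subst sum.remove[of _ i]) (auto simp: of_nat_diff)
  finally show ?thesis .
qed

lemma velocity_bound: "i \<in> V \<Longrightarrow> \<bar>velocity i t\<bar> \<le> R"
proof -
  assume i: "i \<in> V"
  let ?S = "\<Sum>j\<in>V. A i j * sin (\<theta> j (t - \<tau> i j) - \<theta> i t)"
  have "\<bar>\<kappa> / (real N - 1) * ?S\<bar> = \<kappa> / (real N - 1) * \<bar>?S\<bar>"
    using kappa N2 by (simp add: abs_mult)
  also have "\<dots> \<le> \<kappa> / (real N - 1) * (real N - 1)"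
    using kappa N2 by (intro mult_left_mono row_sum_le i) auto
  also have "\<dots> = \<kappa>" using N2 by simp
  finally show ?thesis using speed[OF i] unfolding velocity_def by linarith
qed

lemma phase_lipschitz:
  assumes i: "i \<in> V" and st: "0 \<le> s" "s \<le> t"
  shows "\<bar>\<theta> i t - \<theta> i s\<bar> \<le> R * (t - s)"
proof (cases "s = t")
  case False
  then have lt: "s < t" using st by simp
  have "continuous_on {s..t} (\<theta> i)"
    using continuous_on_subset[OF phase_cont[OF i]] st by auto
  moreover have "\<theta> i differentiable (at u)" if "s < u" "u < t" for u
    using phase_deriv[OF i, of u] that st real_differentiable_def by auto
  ultimately obtain l z where z: "s < z" "z < t" "(\<theta> i has_real_derivative l) (at z)"
      "\<theta> i t - \<theta> i s = (t - s) * l"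
    using MVT[OF lt] by blast
  have "l = velocity i z" using z phase_deriv[OF i, of z] st DERIV_unique by auto
  then have "\<bar>l\<bar> \<le> R" using velocity_bound[OF i] by simp
  then show ?thesis using z(4) lt by (simp add: abs_mult mult.commute mult_right_mono)
qed simp

text \<open>
  A path from inside \<open>S\<close> to outside \<open>S\<close> has to use an arc that leaves \<open>S\<close>.
\<close>

lemma arc_leaving:
  assumes S: "S \<subseteq> V" "S \<noteq> {}" "S \<noteq> V"
  shows "\<exists>i\<in>S. \<exists>j\<in>V - S. A i j = 1"
proof (rule ccontr)
  assume no: "\<not> ?thesis"
  obtain u v where uv: "u \<in> S" "v \<in> V" "v \<notin> S" using S by blast
  have uV: "u \<in> V" using uv S by auto
  have "v \<in> S" using A_conn[OF uV uv(2)] uv(1)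
  proof (induction rule: rtrancl_induct)
    case (step y z)
    then show ?case using no by blast
  qed
  then show False using uv by simp
qed

abbreviation W where "W \<equiv> \<Sum>m\<in>V. w m"

lemma w_nonneg: "m \<in> V \<Longrightarrow> 0 \<le> w m"
  using w_ge_1[of m] by simp

lemma W_pos: "W > 0"
  using w_ge_1 N2 by (intro sum_pos) (auto intro: less_le_trans[OF zero_less_one])

lemma permutes_in: "\<lbrakk>p permutes V; m \<in> V\<rbrakk> \<Longrightarrow> p m \<in> V"
  by (metis permutes_in_image)

lemma weighted_diff_le:
  assumes "\<And>m. m \<in> V \<Longrightarrow> y m - z m \<le> d"
  shows "weighted y - weighted z \<le> W * d"
proof -
  have "weighted y - weighted z = (\<Sum>m\<in>V. w m * (y m - z m))"
    by (simp add: weighted_def sum_subtractf right_diff_distrib)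
  also have "\<dots> \<le> (\<Sum>m\<in>V. w m * d)" by (intro sum_mono mult_left_mono assms w_nonneg)
  finally show ?thesis by (simp add: sum_distrib_right)
qed

lemma weighted_uminus: "weighted (\<lambda>m. - y m) = - weighted y"
  by (simp add: weighted_def sum_negf)

definition rate where
  "rate = 2 * \<kappa> * (sin \<xi> / \<xi>) * cos (R * T) / ((real N - 1) * W)"

text \<open>
  A pair \<open>(p, q)\<close> that maximises the difference of weighted sums consists of a permutation \<open>p\<close>
  sorting \<open>x\<close> upwards and a permutation \<open>q\<close> sorting it downwards. So both the top and the bottom
  part of the Lyapunov function are covered by the drift estimate for maximisers.
\<close>

context
  fixes x :: "nat \<Rightarrow> real" and p q :: "nat \<Rightarrow> nat"
  assumes p: "p permutes V" and q: "q permutes V"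
    and max: "\<And>p' q'. \<lbrakk>p' permutes V; q' permutes V\<rbrakk> \<Longrightarrow>
       weighted (x \<circ> p') - weighted (x \<circ> q') \<le> weighted (x \<circ> p) - weighted (x \<circ> q)"
begin

lemma max_p: "p' permutes V \<Longrightarrow> weighted (x \<circ> p') \<le> weighted (x \<circ> p)"
  using max[OF _ q] by simp

lemma max_q: "q' permutes V \<Longrightarrow> weighted ((\<lambda>i. - x i) \<circ> q') \<le> weighted ((\<lambda>i. - x i) \<circ> q)"
  using max[OF p] by (simp add: comp_def weighted_uminus)

lemma p_extremes: "i \<in> V \<Longrightarrow> x (p 1) \<le> x i \<and> x i \<le> x (p N)"
proof -
  assume "i \<in> V"
  then obtain k where "k \<in> V" "i = p k" using permutes_image[OF p] by (metis imageE)
  then show ?thesis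
    using maximising_permutation_sorts[OF p max_p, of 1 k]
      maximising_permutation_sorts[OF p max_p, of k N] by auto
qed

lemma q_extremes: "i \<in> V \<Longrightarrow> x (q N) \<le> x i \<and> x i \<le> x (q 1)"
proof -
  assume "i \<in> V"
  then obtain k where "k \<in> V" "i = q k" using permutes_image[OF q] by (metis imageE)
  then show ?thesis
    using maximising_permutation_sorts[OF q max_q, of 1 k]
      maximising_permutation_sorts[OF q max_q, of k N] by auto
qed

text \<open>
  Top and bottom means each lose at most the fraction \<open>1 / \<eta>\<close> of the range.
\<close>

lemma spread_le_functional:
  assumes ij: "i \<in> V" "j \<in> V"
  shows "(1 - 2 / \<eta>) * W * (x i - x j) \<le> weighted (x \<circ> p) - weighted (x \<circ> q)"
proof -
  define d where "d = x (p N) - x (p 1)"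
  have NV: "N \<in> V" "1 \<in> V" using N2 by auto
  have d0: "0 \<le> d" using p_extremes[OF permutes_in[OF p NV(2)]] by (simp add: d_def)
  have qN: "x (q N) = x (p 1)"
    using p_extremes[OF permutes_in[OF q NV(1)]] q_extremes[OF permutes_in[OF p NV(2)]] by simp
  have split: "sum f V = f N + sum f (V - {N})" for f :: "nat \<Rightarrow> real"
    using NV by (intro sum.remove) auto
  have "weighted (x \<circ> p) - weighted (x \<circ> q) = (\<Sum>m\<in>V. w m * (x (p m) - x (q m)))"
    by (simp add: weighted_def sum_subtractf right_diff_distrib)
  also have "\<dots> = w N * d + (\<Sum>m\<in>V - {N}. w m * (x (p m) - x (q m)))"
    unfolding split[of "\<lambda>m. w m * (x (p m) - x (q m))"] by (simp add: qN d_def)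
  also have "\<dots> \<ge> w N * d + (\<Sum>m\<in>V - {N}. w m * (- d))"
  proof (intro add_left_mono sum_mono mult_left_mono)
    fix m assume m: "m \<in> V - {N}"
    show "- d \<le> x (p m) - x (q m)"
      using p_extremes[OF permutes_in[OF p, of m]] p_extremes[OF permutes_in[OF q, of m]] m
      by (simp add: d_def)
    show "0 \<le> w m" using m w_nonneg by simp
  qed
  also have "w N * d + (\<Sum>m\<in>V - {N}. w m * (- d)) = (2 * w N - W) * d"
    unfolding split[of w] sum_distrib_right[symmetric] by (simp add: algebra_simps)
  finally have 1: "(2 * w N - W) * d \<le> weighted (x \<circ> p) - weighted (x \<circ> q)" .
  have "(1 - 2 / \<eta>) * W \<le> 2 * w N - W"
    using w_top_share[OF N2] by (simp add: algebra_simps)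
  then have "(1 - 2 / \<eta>) * W * d \<le> (2 * w N - W) * d" using d0 by (intro mult_right_mono)
  moreover have "(1 - 2 / \<eta>) * W * (x i - x j) \<le> (1 - 2 / \<eta>) * W * d"
    using p_extremes[OF ij(1)] p_extremes[OF ij(2)] beta_pos W_pos
    by (intro mult_left_mono) (auto simp: d_def)
  ultimately show ?thesis using 1 by linarith
qed

text \<open>
  The drift estimate for \<open>x\<close> with \<open>p\<close> and for \<open>- x\<close> with \<open>q\<close>, added up. The range of \<open>x\<close> in these
  estimates is bounded below by the functional divided by \<open>W\<close>, which closes the differential inequality.
\<close>

lemma functional_drift:
  assumes spread: "\<And>i j. \<lbrakk>i \<in> V; j \<in> V\<rbrakk> \<Longrightarrow> x i - x j \<le> \<xi>"
    and e: "\<And>i j. \<lbrakk>i \<in> V; j \<in> V\<rbrakk> \<Longrightarrow> \<bar>e i j\<bar> \<le> R * T"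
    and v: "\<And>i. v i = \<Omega> i + \<kappa> / (real N - 1) * (\<Sum>j\<in>V. A i j * sin (x j + e i j - x i))"
  shows "weighted (v \<circ> p) - weighted (v \<circ> q)
    \<le> W * (\<delta> + 2 * \<kappa> * sin (R * T)) - rate * (weighted (x \<circ> p) - weighted (x \<circ> q))"
proof -
  define F where "F = weighted (x \<circ> p) - weighted (x \<circ> q)"
  define l where "l = sin \<xi> / \<xi> * cos (R * T)"
  define U where "U = (\<Sum>m\<in>V. w m * (\<Sum>j\<in>V. A (p m) j * sin (x j + e (p m) j - x (p m))))"
  define L where "L = (\<Sum>m\<in>V. w m * (\<Sum>j\<in>V. A (q m) j * sin (x j + e (q m) j - x (q m))))"
  have N1: "1 \<le> N" using N2 by simp
  have NV: "N \<in> V" "1 \<in> V" using N2 by auto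
  have l0: "0 \<le> l"
    unfolding l_def using xi_pos xi cos_RT sin_ge_zero[of \<xi>] by (intro mult_nonneg_nonneg) auto
  have RT: "0 \<le> R * T" "R * T \<le> pi / 2" using RT_pos lag pi_gt3 by auto
  have "U \<le> W * ((real N - 1) * sin (R * T)) - l * (x (p N) - x (p 1))"
    unfolding U_def l_def
    using drift_of_maximiser[OF N1 p max_p spread xi_pos xi eta_xi A01 A_irrefl arc_leaving e RT cos_RT]
    by simp
  moreover have "F \<le> W * (x (p N) - x (p 1))"
    unfolding F_def
  proof (rule weighted_diff_le)
    fix m assume m: "m \<in> V"
    show "(x \<circ> p) m - (x \<circ> q) m \<le> x (p N) - x (p 1)"
      using p_extremes[OF permutes_in[OF p m]] p_extremes[OF permutes_in[OF q m]] by simp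
  qed
  then have "l / W * F \<le> l / W * (W * (x (p N) - x (p 1)))" using l0 W_pos by (intro mult_left_mono) auto
  then have "l / W * F \<le> l * (x (p N) - x (p 1))" using W_pos by simp
  ultimately have U: "U \<le> W * ((real N - 1) * sin (R * T)) - l / W * F" by linarith
  have "- L = (\<Sum>m\<in>V. w m * (\<Sum>j\<in>V. A (q m) j * sin (- x j + - e (q m) j - - x (q m))))"
  proof -
    have "sin (- x j + - e i j - - x i) = - sin (x j + e i j - x i)" for i j
      unfolding sin_minus[symmetric] by (rule arg_cong[of _ _ sin]) simp
    then show ?thesis unfolding L_def by (simp add: sum_negf)
  qed
  also have "\<dots> \<le> W * ((real N - 1) * sin (R * T)) - l * (- x (q N) - - x (q 1))"
    unfolding l_def
  proof (rule drift_of_maximiser[OF N1 q max_q _ xi_pos xi eta_xi A01 A_irrefl arc_leaving _ RT cos_RT])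
    show "- x i - - x j \<le> \<xi>" if "i \<in> V" "j \<in> V" for i j using spread[OF that(2,1)] by simp
    show "\<bar>- e i j\<bar> \<le> R * T" if "i \<in> V" "j \<in> V" for i j using e[OF that] by simp
  qed
  finally have "- L \<le> W * ((real N - 1) * sin (R * T)) - l * (x (q 1) - x (q N))" by simp
  moreover have "F \<le> W * (x (q 1) - x (q N))"
    unfolding F_def
  proof (rule weighted_diff_le)
    fix m assume m: "m \<in> V"
    show "(x \<circ> p) m - (x \<circ> q) m \<le> x (q 1) - x (q N)"
      using q_extremes[OF permutes_in[OF p m]] q_extremes[OF permutes_in[OF q m]] by simp
  qed
  then have "l / W * F \<le> l / W * (W * (x (q 1) - x (q N)))" using l0 W_pos by (intro mult_left_mono) auto
  then have "l / W * F \<le> l * (x (q 1) - x (q N))" using W_pos by simp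
  ultimately have L: "- L \<le> W * ((real N - 1) * sin (R * T)) - l / W * F" by linarith
  have wv: "weighted (v \<circ> s) = weighted (\<Omega> \<circ> s) +
      \<kappa> / (real N - 1) * (\<Sum>m\<in>V. w m * (\<Sum>j\<in>V. A (s m) j * sin (x j + e (s m) j - x (s m))))" for s
    unfolding weighted_def
    by (simp add: v distrib_left sum.distrib sum_distrib_left mult_ac)
  have "weighted (\<Omega> \<circ> p) - weighted (\<Omega> \<circ> q) \<le> W * \<delta>"
    using freq_spread permutes_in[OF p] permutes_in[OF q] by (intro weighted_diff_le) auto
  moreover have "\<kappa> / (real N - 1) * (U + - L)
      \<le> \<kappa> / (real N - 1) * (2 * (W * ((real N - 1) * sin (R * T)) - l / W * F))"
    proof (rule mult_left_mono)
    show "U + - L \<le> 2 * (W * ((real N - 1) * sin (R * T)) - l / W * F)" using add_mono[OF U L] by (simp only: mult_2)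
  qed (use kappa N2 in simp)
  moreover have "\<kappa> / (real N - 1) * (2 * (W * ((real N - 1) * sin (R * T)) - l / W * F))
      = W * (2 * \<kappa> * sin (R * T)) - rate * F"
  proof -
    have balance: "\<kappa> / n * (2 * (W * (n * s) - a * C / W * F)) = W * (2 * \<kappa> * s) - 2 * \<kappa> * a * C / (n * W) * F"
      if "n \<noteq> 0" for n s a C :: real
      using that W_pos by (simp add: field_simps)
    show ?thesis unfolding rate_def l_def by (rule balance) (use N2 in simp)
  qed
  moreover have "\<kappa> / (real N - 1) * (U + - L) = \<kappa> / (real N - 1) * U - \<kappa> / (real N - 1) * L"
    by (simp add: right_diff_distrib)
  ultimately show ?thesis
    unfolding wv U_def[symmetric] L_def[symmetric] F_def[symmetric] distrib_left[of W] by linarith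
qed

end

lemma rate_pos: "rate > 0"
  unfolding rate_def using kappa xi_pos xi cos_RT N2 W_pos sin_gt_zero[of \<xi>]
  by (intro divide_pos_pos mult_pos_pos) auto

lemma maximal_pair_exists:
  obtains p q where "p permutes V" "q permutes V"
    "\<And>p' q'. \<lbrakk>p' permutes V; q' permutes V\<rbrakk> \<Longrightarrow>
       weighted (x \<circ> p') - weighted (x \<circ> q') \<le> weighted (x \<circ> p) - weighted (x \<circ> q)"
proof -
  let ?I = "{p. p permutes V} \<times> {p. p permutes V}"
  let ?F = "\<lambda>(p, q). weighted (x \<circ> p) - weighted (x \<circ> q)"
  have fin: "finite (?F ` ?I)" by (intro finite_imageI finite_cartesian_product finite_permutations) auto
  have ne: "?F ` ?I \<noteq> {}" using permutes_id by blast
  have "Max (?F ` ?I) \<in> ?F ` ?I" by (rule Max_in[OF fin ne])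
  then obtain pq where pq: "Max (?F ` ?I) = ?F pq" "pq \<in> ?I" by (elim imageE)
  have "?F z \<le> ?F pq" if "z \<in> ?I" for z unfolding pq(1)[symmetric] using fin that by (intro Max_ge) auto
  then show thesis using pq(2) by (intro that[of "fst pq" "snd pq"]) (auto split: prod.splits)
qed

text \<open>
  The maximum of these over all pairs of permutations is the total weight times the Lyapunov
  function.
\<close>

definition functional :: "(nat \<Rightarrow> nat) \<times> (nat \<Rightarrow> nat) \<Rightarrow> real \<Rightarrow> real" where
  "functional pq t = weighted ((\<lambda>i. \<theta> i t) \<circ> fst pq) - weighted ((\<lambda>i. \<theta> i t) \<circ> snd pq)"

lemma functional_deriv:
  assumes "p permutes V" "q permutes V" "t > 0"
  shows "(functional (p, q) has_real_derivative
    weighted ((\<lambda>i. velocity i t) \<circ> p) - weighted ((\<lambda>i. velocity i t) \<circ> q)) (at t)"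
  unfolding functional_def weighted_def comp_def fst_conv snd_conv
  using assms(3) permutes_in[OF assms(1)] permutes_in[OF assms(2)]
  by (intro DERIV_diff DERIV_sum DERIV_cmult phase_deriv) auto

lemma functional_cont:
  assumes "p permutes V" "q permutes V"
  shows "continuous_on {T..} (functional (p, q))"
proof -
  have "continuous_on {T..} (\<theta> i)" if "i \<in> V" for i
    using phase_cont[OF that] T0 by (auto intro: continuous_on_subset)
  then show ?thesis
    unfolding functional_def weighted_def comp_def fst_conv snd_conv
    using permutes_in[OF assms(1)] permutes_in[OF assms(2)]
    by (intro continuous_intros) auto
qed

text \<open>
  The differential inequality \<open>F' \<le> W * n - rate * F\<close> holds for a maximal \<open>F\<close> as long as the
  diameter is at most \<open>\<xi>\<close>. Its equilibrium is \<open>W * n / rate\<close>, so every \<open>k0\<close> strictly between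
  \<open>n / rate\<close> and \<open>(1 - 2 / \<eta>) * dinf\<close> gives a barrier that relaxes to \<open>W * k0\<close> at the same rate and is
  crossed by no member of the family; the midpoint is taken. The barrier starts
  at \<open>W * \<zeta>\<close> and decreases, which keeps the diameter at a first contact below \<open>\<xi>\<close>.
\<close>

lemma functional_below_barrier:
  defines "k0 \<equiv> ((\<delta> + 2 * \<kappa> * sin (R * T)) / rate + (1 - 2 / \<eta>) * dinf) / 2"
  assumes pq: "p permutes V" "q permutes V" and t: "t \<ge> T"
  shows "functional (p, q) t < W * (k0 + (\<zeta> - k0) * exp (- rate * (t - T)))"
    and "k0 < (1 - 2 / \<eta>) * dinf"
proof -
  let ?b = "\<lambda>t. W * (k0 + (\<zeta> - k0) * exp (- rate * (t - T)))"
  define n where "n = \<delta> + 2 * \<kappa> * sin (R * T)"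
  have "n < rate * ((1 - 2 / \<eta>) * dinf)" using strong unfolding n_def rate_def .
  then have neq: "n / rate < (1 - 2 / \<eta>) * dinf" using rate_pos by (simp add: field_simps)
  have "2 * k0 = n / rate + (1 - 2 / \<eta>) * dinf" unfolding k0_def n_def by simp
  then have k0: "n / rate < k0" "k0 < (1 - 2 / \<eta>) * dinf" using neq by linarith+
  then show "k0 < (1 - 2 / \<eta>) * dinf" by simp
  have "(1 - 2 / \<eta>) * dinf \<le> 1 * dinf" using eta_gt2 dinf by (intro mult_right_mono) auto
  then have k0z: "k0 < \<zeta>" using k0(2) dinf(2) by linarith
  show "functional (p, q) t < ?b t"
  proof (rule finite_family_barrier[where I = "{p. p permutes V} \<times> {p. p permutes V}" and F = functional and a = T])
    show "finite ({p. p permutes V} \<times> {p. p permutes V})" by (simp add: finite_permutations)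
    show "(p, q) \<in> {p. p permutes V} \<times> {p. p permutes V}" using pq by simp
    show "T \<le> t" by fact
    show "continuous_on {T..} (functional i)" if "i \<in> {p. p permutes V} \<times> {p. p permutes V}" for i
      using that functional_cont by auto
    show "continuous_on {T..} ?b" by (intro continuous_intros)
    show "functional i T < ?b T" if "i \<in> {p. p permutes V} \<times> {p. p permutes V}" for i
    proof -
      obtain p' q' where i: "i = (p', q')" "p' permutes V" "q' permutes V" using \<open>i \<in> _\<close> by auto
      have "functional i T \<le> W * (D0 + 2 * (R * T))"
        unfolding functional_def i fst_conv snd_conv
      proof (rule weighted_diff_le)
        fix m assume m: "m \<in> V"
        have "\<bar>\<theta> (p' m) T - \<theta> (p' m) 0\<bar> \<le> R * T" "\<bar>\<theta> (q' m) T - \<theta> (q' m) 0\<bar> \<le> R * T"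
          using phase_lipschitz[of _ 0 T] permutes_in i m T0 by (auto simp: less_imp_le)
        moreover have "\<theta> (p' m) 0 - \<theta> (q' m) 0 \<le> D0" using initial permutes_in i m by blast
        ultimately show "((\<lambda>i. \<theta> i T) \<circ> p') m - ((\<lambda>i. \<theta> i T) \<circ> q') m \<le> D0 + 2 * (R * T)" by simp
      qed
      also have "\<dots> < W * \<zeta>" using room W_pos by simp
      finally show ?thesis by simp
    qed
    fix i t assume i: "i \<in> {p. p permutes V} \<times> {p. p permutes V}" and t: "T < t"
      and le: "\<And>j. j \<in> {p. p permutes V} \<times> {p. p permutes V} \<Longrightarrow> functional j t \<le> ?b t"
      and eq: "functional i t = ?b t"
    obtain p' q' where pq': "i = (p', q')" "p' permutes V" "q' permutes V" using i by auto
    let ?x = "\<lambda>i. \<theta> i t"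
    have max: "weighted (?x \<circ> r) - weighted (?x \<circ> s) \<le> weighted (?x \<circ> p') - weighted (?x \<circ> q')"
      if "r permutes V" "s permutes V" for r s
      using le[of "(r, s)"] that eq unfolding pq' functional_def by simp
    have t0: "t > 0" using t T0 by simp
    have "exp (- rate * (t - T)) \<le> 1" using rate_pos t by simp
    then have "(\<zeta> - k0) * exp (- rate * (t - T)) \<le> (\<zeta> - k0) * 1" using k0z by (intro mult_left_mono) auto
    then have "?b t \<le> W * \<zeta>" using W_pos by (intro mult_left_mono) auto
    have spread: "\<theta> a t - \<theta> b t \<le> \<xi>" if "a \<in> V" "b \<in> V" for a b
    proof -
      have "(1 - 2 / \<eta>) * W * (\<theta> a t - \<theta> b t) \<le> functional i t"
        using spread_le_functional[OF pq'(2,3) max that] unfolding functional_def pq' by simp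
      also have "\<dots> \<le> W * \<zeta>" using eq \<open>?b t \<le> W * \<zeta>\<close> by simp
      also have "\<dots> \<le> W * ((1 - 2 / \<eta>) * \<xi>)" using zeta W_pos by (intro mult_left_mono) auto
      finally have "((1 - 2 / \<eta>) * W) * (\<theta> a t - \<theta> b t) \<le> ((1 - 2 / \<eta>) * W) * \<xi>"
        by (simp add: mult_ac)
      then show ?thesis using beta_pos W_pos by (simp add: mult_le_cancel_left_pos)
    qed
    have lagged: "\<bar>\<theta> b (t - \<tau> a b) - \<theta> b t\<bar> \<le> R * T" if "a \<in> V" "b \<in> V" for a b
    proof -
      have d: "0 \<le> \<tau> a b" "\<tau> a b \<le> T" using delays[OF that] by auto
      have "\<bar>\<theta> b t - \<theta> b (t - \<tau> a b)\<bar> \<le> R * (t - (t - \<tau> a b))"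
        using d t by (intro phase_lipschitz that) auto
      also have "\<dots> \<le> R * T" using d R_pos by simp
      finally show ?thesis by (simp add: abs_minus_commute)
    qed
    have drift: "weighted ((\<lambda>i. velocity i t) \<circ> p') - weighted ((\<lambda>i. velocity i t) \<circ> q')
        \<le> W * n - rate * functional i t"
      using functional_drift[OF pq'(2,3) max spread lagged, where v = "\<lambda>i. velocity i t"]
      unfolding n_def functional_def pq' velocity_def by simp
    have "n < rate * k0" using k0(1) rate_pos by (simp add: field_simps)
    then have "W * n < W * (rate * k0)" using W_pos by simp
    then have "W * n - rate * ?b t < W * (rate * k0) - rate * ?b t" by simp
    also have "\<dots> = W * ((\<zeta> - k0) * (exp (- rate * (t - T)) * (- rate)))" by (simp add: algebra_simps)
    finally have less: "W * n - rate * functional i t < W * ((\<zeta> - k0) * (exp (- rate * (t - T)) * (- rate)))"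
      using eq by simp
    have "(?b has_real_derivative W * ((\<zeta> - k0) * (exp (- rate * (t - T)) * (- rate)))) (at t)"
      by (auto intro!: derivative_eq_intros)
    then show "\<exists>D D'. (functional i has_real_derivative D) (at t) \<and> (?b has_real_derivative D') (at t) \<and> D < D'"
      using functional_deriv[OF pq'(2,3) t0] drift less unfolding pq'(1)
      by (meson le_less_trans)
  qed
qed

theorem eventual_cohesion:
  "\<exists>t1\<ge>T. \<forall>t\<ge>t1. \<forall>i\<in>V. \<forall>j\<in>V. \<theta> i t - \<theta> j t \<le> dinf"
proof -
  define k0 where "k0 = ((\<delta> + 2 * \<kappa> * sin (R * T)) / rate + (1 - 2 / \<eta>) * dinf) / 2"
  have k0: "k0 < (1 - 2 / \<eta>) * dinf"
    using functional_below_barrier(2)[OF permutes_id permutes_id order_refl] unfolding k0_def .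
  have "((\<lambda>t. exp (- (rate * (t - T)))) \<longlongrightarrow> 0) at_top"
    by (intro filterlim_compose[OF exp_at_bot] filterlim_compose[OF filterlim_uminus_at_bot_at_top]
        filterlim_tendsto_pos_mult_at_top[OF tendsto_const rate_pos]
        filterlim_tendsto_add_at_top[of "\<lambda>_. - T" "- T", simplified] filterlim_ident)
  then have "((\<lambda>t. k0 + (\<zeta> - k0) * exp (- rate * (t - T))) \<longlongrightarrow> k0 + (\<zeta> - k0) * 0) at_top"
    by (intro tendsto_intros) simp
  then have "eventually (\<lambda>t. k0 + (\<zeta> - k0) * exp (- rate * (t - T)) < (1 - 2 / \<eta>) * dinf) at_top"
    using k0 by (intro order_tendstoD(2)) auto
  then obtain t2 where t2: "\<And>t. t \<ge> t2 \<Longrightarrow> k0 + (\<zeta> - k0) * exp (- rate * (t - T)) < (1 - 2 / \<eta>) * dinf"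
    by (auto simp: eventually_at_top_linorder)
  have "\<theta> i t - \<theta> j t \<le> dinf" if t: "t \<ge> max T t2" and ij: "i \<in> V" "j \<in> V" for t i j
  proof -
    obtain p q where pq: "p permutes V" "q permutes V"
      "\<And>p' q'. \<lbrakk>p' permutes V; q' permutes V\<rbrakk> \<Longrightarrow> weighted ((\<lambda>i. \<theta> i t) \<circ> p') - weighted ((\<lambda>i. \<theta> i t) \<circ> q')
         \<le> weighted ((\<lambda>i. \<theta> i t) \<circ> p) - weighted ((\<lambda>i. \<theta> i t) \<circ> q)"
      using maximal_pair_exists[of "\<lambda>i. \<theta> i t"] by blast
    have "(1 - 2 / \<eta>) * W * (\<theta> i t - \<theta> j t) \<le> functional (p, q) t"
      using spread_le_functional[OF pq ij] by (simp add: functional_def)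
    also have "\<dots> \<le> W * (k0 + (\<zeta> - k0) * exp (- rate * (t - T)))"
      using functional_below_barrier(1)[OF pq(1,2), of t] t unfolding k0_def by simp
    also have "\<dots> \<le> W * ((1 - 2 / \<eta>) * dinf)"
      using t2[of t] t W_pos by (intro mult_left_mono) auto
    finally have "((1 - 2 / \<eta>) * W) * (\<theta> i t - \<theta> j t) \<le> ((1 - 2 / \<eta>) * W) * dinf"
      by (simp add: mult_ac)
    then show ?thesis using beta_pos W_pos by (simp add: mult_le_cancel_left_pos)
  qed
  then show ?thesis by (intro exI[of _ "max T t2"]) auto
qed

text \<open>
  The derivative of the coupling term with respect to the phase difference.
\<close>

definition coupling :: "nat \<Rightarrow> nat \<Rightarrow> real \<Rightarrow> real" where
  "coupling i j t = \<kappa> / (real N - 1) * (A i j * cos (\<theta> j (t - \<tau> i j) - \<theta> i t))"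

text \<open>
  The condition \<open>t > T\<close> makes all delayed times positive, where the phases are differentiable.
\<close>

lemma velocity_deriv:
  assumes i: "i \<in> V" and t: "t > T"
  shows "(velocity i has_real_derivative
    (\<Sum>j\<in>V. coupling i j t * (velocity j (t - \<tau> i j) - velocity i t))) (at t)"
proof -
  have summand: "((\<lambda>t. A i j * sin (\<theta> j (t - \<tau> i j) - \<theta> i t)) has_real_derivative
      A i j * (cos (\<theta> j (t - \<tau> i j) - \<theta> i t) * (velocity j (t - \<tau> i j) - velocity i t))) (at t)"
    if j: "j \<in> V" for j
  proof -
    have "t - \<tau> i j > 0" using delays[OF i j] t by simp
    then have "((\<lambda>t. \<theta> j (t - \<tau> i j)) has_real_derivative velocity j (t - \<tau> i j)) (at t)"
      using DERIV_shift[of "\<theta> j" "velocity j (t - \<tau> i j)" t "- \<tau> i j"] phase_deriv[OF j] by simp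
    then show ?thesis
      using phase_deriv[OF i, of t] t T0
      by (auto intro!: derivative_eq_intros simp: algebra_simps)
  qed
  have "((\<lambda>t. \<Omega> i + \<kappa> / (real N - 1) * (\<Sum>j\<in>V. A i j * sin (\<theta> j (t - \<tau> i j) - \<theta> i t)))
      has_real_derivative 0 + \<kappa> / (real N - 1) * (\<Sum>j\<in>V.
      A i j * (cos (\<theta> j (t - \<tau> i j) - \<theta> i t) * (velocity j (t - \<tau> i j) - velocity i t)))) (at t)"
    by (rule DERIV_add[OF DERIV_const DERIV_cmult[OF DERIV_sum[OF summand]]])
  moreover have "velocity i = (\<lambda>t. \<Omega> i +
      \<kappa> / (real N - 1) * (\<Sum>j\<in>V. A i j * sin (\<theta> j (t - \<tau> i j) - \<theta> i t)))"
    by (simp add: fun_eq_iff velocity_def)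
  moreover have "0 + \<kappa> / (real N - 1) * (\<Sum>j\<in>V.
      A i j * (cos (\<theta> j (t - \<tau> i j) - \<theta> i t) * (velocity j (t - \<tau> i j) - velocity i t)))
    = (\<Sum>j\<in>V. coupling i j t * (velocity j (t - \<tau> i j) - velocity i t))"
    by (simp add: coupling_def sum_distrib_left mult_ac)
  ultimately show ?thesis by simp
qed

text \<open>
  Once all phases are within \<open>dinf\<close>, delayed phase differences are at most \<open>dinf + R T < pi / 2\<close>;
  hence the coupling is nonnegative, and bounded away from \<open>0\<close> along arcs.
\<close>

theorem frequencies_synchronise:
  assumes ij: "i \<in> V" "j \<in> V"
  shows "((\<lambda>t. velocity i t - velocity j t) \<longlongrightarrow> 0) at_top"
proof -
  obtain t1 where t1: "t1 \<ge> T" and coh: "\<And>t i j. \<lbrakk>t \<ge> t1; i \<in> V; j \<in> V\<rbrakk> \<Longrightarrow> \<theta> i t - \<theta> j t \<le> dinf"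
    using eventual_cohesion by blast
  \<comment> \<open>Cohesion has to hold, and the law of the velocities to be valid, on the whole history \<open>[t0 - T, t0]\<close>.\<close>
  define t0 where "t0 = t1 + T + 1"
  define E where "E = {(i, j). i \<in> V \<and> j \<in> V \<and> A i j = 1}"
  define c where "c = cos (dinf + R * T)"
  have c: "0 < c" "c \<le> 1" using lag RT_pos dinf by (auto simp: c_def intro!: cos_gt_zero_pi)
  have cosb: "c \<le> cos (\<theta> b (t - \<tau> a b) - \<theta> a t)" if ab: "a \<in> V" "b \<in> V" and t: "t \<ge> t0" for a b t
  proof -
    have d: "0 \<le> \<tau> a b" "\<tau> a b \<le> T" using delays[OF ab] by auto
    have "\<bar>\<theta> b t - \<theta> b (t - \<tau> a b)\<bar> \<le> R * (t - (t - \<tau> a b))"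
      using d t t1 T0 by (intro phase_lipschitz ab) (auto simp: t0_def)
    also have "\<dots> \<le> R * T" using d R_pos by simp
    finally have "\<bar>\<theta> b (t - \<tau> a b) - \<theta> a t\<bar> \<le> dinf + R * T"
      using coh[of t a b] coh[of t b a] ab t T0 unfolding t0_def by linarith
    then have "cos (dinf + R * T) \<le> cos \<bar>\<theta> b (t - \<tau> a b) - \<theta> a t\<bar>"
      using lag by (intro cos_monotone_0_pi_le) auto
    then show ?thesis by (simp add: c_def)
  qed
  have N1: "real N - 1 \<ge> 1" using N2 by simp
  interpret cw: connected_delayed_weights V \<tau> coupling T t0 \<kappa> "\<kappa> / (real N - 1) * c" E
  proof
    show "finite V" by simp
    show "0 \<le> \<tau> a b \<and> \<tau> a b \<le> T" if "a \<in> V" "b \<in> V" for a b using delays[OF that] .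
    show "0 \<le> coupling a b t" if "a \<in> V" "b \<in> V" "t0 \<le> t" for a b t
      unfolding coupling_def using cosb[OF that] c A01[of a b] kappa N1
      by (intro mult_nonneg_nonneg) auto
    show "(\<Sum>b\<in>V. coupling a b t) \<le> \<kappa>" if a: "a \<in> V" and "t0 \<le> t" for a t
    proof -
      have "(\<Sum>b\<in>V. coupling a b t) = \<kappa> / (real N - 1) * (\<Sum>b\<in>V. A a b * cos (\<theta> b (t - \<tau> a b) - \<theta> a t))"
        by (simp add: coupling_def sum_distrib_left)
      also have "\<dots> \<le> \<kappa> / (real N - 1) * (real N - 1)"
        using row_sum_le[OF a, of "\<lambda>b. cos (\<theta> b (t - \<tau> a b) - \<theta> a t)"] kappa N1
        by (intro mult_left_mono) auto
      finally show ?thesis using N1 by simp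
    qed
    show "0 < \<kappa>" "0 \<le> T" using kappa T0 by auto
    show "0 < \<kappa> / (real N - 1) * c" using kappa N1 c by simp
    have "\<kappa> / (real N - 1) * c \<le> \<kappa> / 1 * 1"
      using kappa N1 c by (intro mult_mono divide_left_mono) auto
    then show "\<kappa> / (real N - 1) * c \<le> \<kappa>" by simp
    show "E \<subseteq> V \<times> V" by (auto simp: E_def)
    show "\<kappa> / (real N - 1) * c \<le> coupling a b t" if ab: "(a, b) \<in> E" and t: "t0 \<le> t" for a b t
    proof -
      have "a \<in> V" "b \<in> V" "A a b = 1" using ab by (auto simp: E_def)
      then show ?thesis
        unfolding coupling_def using cosb[of a b t] t kappa N1 by (intro mult_left_mono) auto
    qed
    show "(a, b) \<in> E\<^sup>*" if "a \<in> V" "b \<in> V" for a b using A_conn[OF that] by (simp add: E_def)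
    show "V \<noteq> {}" using N2 by simp
  qed
  have "consensus_flow V \<tau> coupling T t0 velocity"
    unfolding consensus_flow_def
  proof (intro ballI conjI allI impI)
    fix a assume a: "a \<in> V"
    have d: "(velocity a has_real_derivative
        (\<Sum>b\<in>V. coupling a b t * (velocity b (t - \<tau> a b) - velocity a t))) (at t)" if "t \<ge> t0 - T" for t
      using that t1 by (intro velocity_deriv a) (auto simp: t0_def)
    show "continuous_on {t0 - T..} (velocity a)"
      using d DERIV_isCont by (intro continuous_at_imp_continuous_on) fastforce
    show "(velocity a has_real_derivative
        (\<Sum>b\<in>V. coupling a b t * (velocity b (t - \<tau> a b) - velocity a t))) (at t)" if "t \<ge> t0" for t
      using d[of t] that T0 by simp
  qed
  from cw.consensus[OF this ij] show ?thesis .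
qed

end
section \<open>Frequency synchronisation under explicit coupling bounds\<close>

lemma pair_le_Max:
  fixes f :: "nat \<Rightarrow> nat \<Rightarrow> real"
  assumes "finite S" "i \<in> S" "j \<in> S"
  shows "f i j \<le> (MAX (i, j)\<in>S \<times> S. f i j)"
proof -
  have "(\<lambda>(i, j). f i j) (i, j) \<le> (MAX (i, j)\<in>S \<times> S. f i j)"
    using assms by (intro Max_ge imageI finite_imageI) auto
  then show ?thesis by simp
qed

lemma pair_Max_le:
  fixes f :: "nat \<Rightarrow> nat \<Rightarrow> real"
  assumes "finite S" "S \<noteq> {}" "\<And>i j. \<lbrakk>i \<in> S; j \<in> S\<rbrakk> \<Longrightarrow> f i j \<le> b"
  shows "(MAX (i, j)\<in>S \<times> S. f i j) \<le> b"
  using assms by (intro Max.boundedI) auto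

theorem theorem3p1:
  fixes N :: nat
    and G :: "nat pair_pre_digraph"
    and \<Omega> :: "nat \<Rightarrow> real"
    and \<kappa> :: real
    and \<tau> :: "nat \<Rightarrow> nat \<Rightarrow> real"
    and \<theta>0 \<theta> :: "nat \<Rightarrow> real \<Rightarrow> real"
    and T R D0 \<zeta> \<xi> dinf \<eta> \<beta> c :: real
  assumes "N \<ge> 2"
    and "pair_loopfree_digraph G"
    and "pverts G = {1..N}"
    and "strongly_connected (with_proj G)"
    and "\<kappa> > 0"
    and "\<forall>i\<in>{1..N}. \<forall>j\<in>{1..N}. i \<noteq> j \<longrightarrow> \<tau> i j > 0"
    and "\<forall>i\<in>{1..N}. \<tau> i i = 0"
    and T: "T = max_delay N \<tau>"
    and "\<forall>i\<in>{1..N}. C1_bounded (- T) 0 (\<theta>0 i) \<and> continuous_on {- T..0} (\<theta>0 i)"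
    and "kuramoto_solution N G \<Omega> \<kappa> \<tau> \<theta>0 \<theta>"
    and R: "R = R_omega N \<Omega> \<kappa>"
    and D0: "D0 = D_theta0 N \<tau> \<theta>"
    and "D0 < pi"
    and "D0 < \<zeta>" and "\<zeta> < \<xi>" and "\<xi> < pi"
    and "0 < dinf" and "dinf < min (pi / 2) (d_theta N \<theta> 0)"
    and "\<eta> > Max {1 / sin \<xi>, 1 / cos (R * T), 2 / (1 - \<zeta> / \<xi>)}"
    and \<beta>: "\<beta> = 1 - 2 / \<eta>"
    and c: "c = ((\<Sum>j=1..N - 1. \<eta> ^ j * k_perms (2 * N) j) + 1) * \<xi> / sin \<xi>"
    and "tan (R * T) < \<beta> * dinf / ((1 + \<zeta> / (\<zeta> - D0)) * 2 * (real N - 1) * c)"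
    and "dinf + R * T < pi / 2"
    and "\<kappa> > (1 + \<zeta> / (\<zeta> - D0)) *
               ((D_Omega N \<Omega> + 2 * \<kappa> * sin (R * T)) * (real N - 1) * c / (2 * cos (R * T))) *
               (1 / (\<beta> * dinf))"
  shows "(d_omega N \<theta> \<longlongrightarrow> 0) at_top"
proof -
  let ?V = "{1..N}"
  note N2 = assms(1) and loopfree = assms(2) and verts = assms(3) and sc = assms(4)
    and kappa = assms(5) and \<tau>_pos = assms(6) and \<tau>_diag = assms(7) and sol = assms(10)
    and D0_zeta = assms(14) and zeta_xi = assms(15) and xi_pi = assms(16)
    and dinf_pos = assms(17) and dinf_less = assms(18) and eta = assms(19)
    and tan_small = assms(22) and lag = assms(23) and kappa_large = assms(24)
  have V: "finite ?V" "?V \<noteq> {}" using N2 by auto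
  have delay: "0 \<le> \<tau> i j \<and> \<tau> i j \<le> T" if "i \<in> ?V" "j \<in> ?V" for i j
    using \<tau>_pos \<tau>_diag that pair_le_Max[OF V(1) that, of \<tau>] unfolding T max_delay_def
    by (cases "i = j") (auto simp: less_imp_le)
  have "0 < \<tau> 1 2" using \<tau>_pos N2 by simp
  then have T0: "T > 0" using delay[of 1 2] N2 by simp
  have speed: "\<bar>\<Omega> i\<bar> + \<kappa> \<le> R" if "i \<in> ?V" for i
    using that unfolding R R_omega_def by (auto intro!: Max_ge)
  have R0: "R > 0" using speed[of 1] N2 kappa by auto
  have RT: "0 < R * T" "R * T < pi / 2" using R0 T0 lag dinf_pos by auto
  have cosRT: "cos (R * T) > 0" using RT by (intro cos_gt_zero_pi) auto
  have sinRT: "sin (R * T) \<ge> 0" using RT by (intro sin_ge_zero) auto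
  have cont: "continuous_on {- T..} (\<theta> i)" if "i \<in> ?V" for i
    using sol that by (auto simp: kuramoto_solution_def T)
  have chi_irrefl: "chi G i i = 0" for i
    using pair_loopfree_digraph.pair_no_loops[OF loopfree, of "(i, i)"]
    by (auto simp: chi_def neighbours_def)
  have ode: "(\<theta> i has_real_derivative \<Omega> i + \<kappa> / (real N - 1) *
      (\<Sum>j\<in>?V. chi G i j * sin (\<theta> j (t - \<tau> i j) - \<theta> i t))) (at t)" if "i \<in> ?V" "t > 0" for i t
  proof -
    have "(\<Sum>j\<in>?V. chi G i j * sin (\<theta> j (t - \<tau> i j) - \<theta> i t))
        = (\<Sum>j\<in>?V - {i}. chi G i j * sin (\<theta> j (t - \<tau> i j) - \<theta> i t))"
      using that chi_irrefl by (subst sum.remove[of _ i]) auto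
    then show ?thesis using sol that unfolding kuramoto_solution_def by simp
  qed
  have conn: "(i, j) \<in> {(i, j). i \<in> ?V \<and> j \<in> ?V \<and> chi G i j = 1}\<^sup>*" if "i \<in> ?V" "j \<in> ?V" for i j
  proof -
    have "(i, j) \<in> rtrancl_on ?V (parcs G)"
      using sc that verts by (auto simp: strongly_connected_def reachable_def)
    then have "(i, j) \<in> (parcs G)\<^sup>*" by (rule rtrancl_on_rtranclI)
    moreover have "parcs G \<subseteq> {(i, j). i \<in> ?V \<and> j \<in> ?V \<and> chi G i j = 1}"
    proof -
      interpret pair_loopfree_digraph G by (rule loopfree)
      show ?thesis
        using arc_fst_in_verts arc_snd_in_verts verts by (fastforce simp: chi_def neighbours_def)
    qed
    ultimately show ?thesis using rtrancl_mono by blast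
  qed
  have init: "\<bar>\<theta> i 0 - \<theta> j 0\<bar> \<le> D0" if ij: "i \<in> ?V" "j \<in> ?V" for i j
  proof -
    let ?K = "{- T..0} \<times> {- T..0}"
    \<comment> \<open>Compactness bounds the set below the supremum in \<open>D_theta0\<close>, so that the supremum is an upper bound.\<close>
    have "continuous_on ?K (\<lambda>z. \<bar>\<theta> i (fst z) - \<theta> j (snd z)\<bar>)"
      by (intro continuous_intros continuous_on_compose2[OF cont[OF ij(1)]]
          continuous_on_compose2[OF cont[OF ij(2)]]) auto
    then have "compact ((\<lambda>z. \<bar>\<theta> i (fst z) - \<theta> j (snd z)\<bar>) ` ?K)"
      by (intro compact_continuous_image compact_Times compact_Icc)
    then have "bdd_above ((\<lambda>z. \<bar>\<theta> i (fst z) - \<theta> j (snd z)\<bar>) ` ?K)"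
      by (intro bounded_imp_bdd_above compact_imp_bounded)
    then have bdd: "bdd_above ((\<lambda>(s, t). \<bar>\<theta> i s - \<theta> j t\<bar>) ` ?K)"
      by (simp add: case_prod_unfold)
    have "(\<lambda>(s, t). \<bar>\<theta> i s - \<theta> j t\<bar>) (0, 0) \<le> (SUP (s, t)\<in>?K. \<bar>\<theta> i s - \<theta> j t\<bar>)"
      using T0 by (intro cSUP_upper bdd) auto
    also have "\<dots> \<le> D0"
      unfolding D0 D_theta0_def T[symmetric] by (rule pair_le_Max[OF V(1) ij])
    finally show ?thesis by simp
  qed
  have freq: "\<Omega> i - \<Omega> j \<le> D_Omega N \<Omega>" if "i \<in> ?V" "j \<in> ?V" for i j
    using pair_le_Max[OF V(1) that, of "\<lambda>i j. \<bar>\<Omega> i - \<Omega> j\<bar>"] unfolding D_Omega_def by linarith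
  have freq0: "D_Omega N \<Omega> \<ge> 0" using freq[of 1 1] N2 by simp
  have "d_theta N \<theta> 0 \<le> D0" unfolding d_theta_def using init by (intro pair_Max_le V) auto
  then have dinf: "dinf < pi / 2" "dinf < D0" using dinf_less by auto
  have zeta: "0 < \<zeta>" "0 < \<xi>" "0 < \<zeta> - D0" using dinf dinf_pos D0_zeta zeta_xi by auto
  have sin_xi: "0 < sin \<xi>" using zeta xi_pi by (intro sin_gt_zero) auto
  have eta3: "1 / sin \<xi> < \<eta>" "2 / (1 - \<zeta> / \<xi>) < \<eta>" using eta by auto
  have q: "0 < 1 - \<zeta> / \<xi>" "1 - \<zeta> / \<xi> < 1" using zeta zeta_xi by auto
  have "2 / 1 < 2 / (1 - \<zeta> / \<xi>)" using q by (intro divide_strict_left_mono) auto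
  then have eta2: "\<eta> > 2" using eta3(2) by linarith
  have eta_xi: "1 \<le> \<eta> * sin \<xi>" using eta3(1) sin_xi by (simp add: divide_less_eq)
  have "2 / \<eta> < 1 - \<zeta> / \<xi>" using eta3(2) q eta2 by (simp add: divide_less_eq mult.commute)
  then have "\<zeta> / \<xi> < 1 - 2 / \<eta>" by simp
  then have zeta_beta: "\<zeta> < (1 - 2 / \<eta>) * \<xi>" using zeta by (simp add: divide_less_eq)
  have beta: "0 < \<beta>" "\<beta> < 1" using eta2 by (auto simp: \<beta>)
  define w where "w = (\<lambda>m. \<eta> ^ (m - 1) * k_perms (2 * N) (m - 1))"
  define W where "W = (\<Sum>m\<in>?V. w m)"
  interpret gw: geometric_weights N \<eta> w
    unfolding w_def using geometric_weights_k_perms eta2 by simp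
  have cW: "c = W * \<xi> / sin \<xi>" unfolding c W_def w_def using sum_k_perms_weights[of N \<eta>] N2 by simp
  have w_nonneg: "0 \<le> w m" if "m \<in> ?V" for m using gw.w_ge_1[OF that] by simp
  have "w 1 \<le> W" unfolding W_def using N2 w_nonneg by (intro member_le_sum) auto
  then have W1: "1 \<le> W" using gw.w1 by simp
  have "sin \<xi> \<le> \<xi>" using zeta by (intro sin_x_le_x) simp
  then have "1 * sin \<xi> \<le> W * \<xi>" using W1 zeta sin_xi by (intro mult_mono) auto
  then have c1: "1 \<le> c" unfolding cW using sin_xi by (simp add: le_divide_eq)
  \<comment> \<open>The factor \<open>a\<close> serves two purposes: \<open>a \<ge> 2\<close> makes \<open>R T\<close> small, and \<open>(\<zeta> - D0) * a = 2 * \<zeta> - D0 > dinf\<close>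
     leaves room for the growth of the diameter on \<open>[0, T]\<close>.\<close>
  define a where "a = 1 + \<zeta> / (\<zeta> - D0)"
  have a2: "2 \<le> a" unfolding a_def using zeta dinf dinf_pos by (simp add: le_divide_eq)
  have N1: "1 \<le> real N - 1" using N2 by simp
  have "R * T \<le> tan (R * T)" using RT by (intro le_tan_self) auto
  also have "\<dots> < \<beta> * dinf / (a * 2 * (real N - 1) * c)" using tan_small unfolding a_def .
  also have "\<dots> \<le> 1 * dinf / (a * 2 * 1 * 1)"
    using beta dinf_pos a2 N1 c1 by (intro frac_le mult_mono) auto
  finally have RTa: "R * T < dinf / (2 * a)" by (simp add: mult.commute)
  have "dinf / (2 * a) \<le> dinf / 4" using a2 dinf_pos by (intro divide_left_mono) auto
  then have RT_half: "R * T \<le> 1 / 2" using RTa dinf pi_less_4 by simp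
  have "2 * (R * T) < dinf / a" using RTa by (simp add: field_simps)
  also have "dinf / a < \<zeta> - D0"
  proof -
    have "(\<zeta> - D0) * a = 2 * \<zeta> - D0" unfolding a_def using zeta by (simp add: field_simps)
    then have "dinf < (\<zeta> - D0) * a" using dinf D0_zeta by simp
    then show ?thesis using a2 by (simp add: divide_less_eq)
  qed
  finally have room: "D0 + 2 * (R * T) < \<zeta>" by simp
  define n where "n = D_Omega N \<Omega> + 2 * \<kappa> * sin (R * T)"
  have n0: "0 \<le> n" unfolding n_def using freq0 kappa sinRT by simp
  have strong: "n < 2 * \<kappa> * (sin \<xi> / \<xi>) * cos (R * T) / ((real N - 1) * W) * ((1 - 2 / \<eta>) * dinf)"
  proof -
    define b where "b = \<beta> * dinf"
    have b0: "0 < b" unfolding b_def using beta dinf_pos by simp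
    define y where "y = n * (real N - 1) * c / (2 * cos (R * T))"
    have y0: "0 \<le> y" unfolding y_def using n0 N1 c1 cosRT by simp
    have "1 * y * (1 / b) \<le> a * y * (1 / b)" using a2 y0 b0 by (intro mult_right_mono) auto
    also have "\<dots> < \<kappa>" using kappa_large unfolding a_def y_def n_def b_def .
    finally have "y < \<kappa> * b" using b0 by (simp add: divide_less_eq)
    then have "n * (real N - 1) * c < \<kappa> * b * (2 * cos (R * T))"
      unfolding y_def using cosRT by (simp add: divide_less_eq)
    then have "n * ((real N - 1) * c) < 2 * \<kappa> * cos (R * T) * b" by (simp add: mult_ac)
    then have "n < 2 * \<kappa> * cos (R * T) * b / ((real N - 1) * c)"
      using N1 c1 by (subst pos_less_divide_eq) auto
    also have "\<dots> = 2 * \<kappa> * (sin \<xi> / \<xi>) * cos (R * T) / ((real N - 1) * W) * b"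
      unfolding cW by (simp add: mult_ac)
    finally show ?thesis unfolding b_def \<beta> .
  qed
  interpret dk: delayed_kuramoto N \<eta> w "chi G" \<Omega> \<kappa> \<tau> T \<theta> R "D_Omega N \<Omega>" D0 \<zeta> \<xi> dinf
  proof
    show "continuous_on {0..} (\<theta> i)" if "i \<in> ?V" for i
      using cont[OF that] T0 by (auto intro: continuous_on_subset)
    show "chi G i j = 0 \<or> chi G i j = 1" for i j by (simp add: chi_def)
    show "\<theta> i 0 - \<theta> j 0 \<le> D0" if "i \<in> ?V" "j \<in> ?V" for i j using init[OF that] by simp
    show "D_Omega N \<Omega> + 2 * \<kappa> * sin (R * T) < 2 * \<kappa> * (sin \<xi> / \<xi>) * cos (R * T) /
        ((real N - 1) * (\<Sum>m\<in>?V. w m)) * ((1 - 2 / \<eta>) * dinf)"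
      using strong unfolding n_def W_def .
    show "dinf < \<zeta>" using dinf D0_zeta by simp
  qed (fact N2 kappa delay T0 ode chi_irrefl conn speed freq freq0 room dinf_pos xi_pi eta_xi eta2
      zeta_beta RT_half lag)+
  have omega: "omega \<theta> i t = dk.velocity i t" if "i \<in> ?V" "t > 0" for i t
    using DERIV_imp_deriv[OF dk.phase_deriv[OF that]] that by (simp add: omega_def)
  show ?thesis
  proof (rule tendsto_sandwich[of "\<lambda>_. 0" _ _
        "\<lambda>t. \<Sum>i\<in>?V. \<Sum>j\<in>?V. \<bar>dk.velocity i t - dk.velocity j t\<bar>"])
    have "0 \<le> d_omega N \<theta> t" for t
      unfolding d_omega_def using pair_le_Max[OF V(1), of 1 1 "\<lambda>i j. \<bar>omega \<theta> i t - omega \<theta> j t\<bar>"] N2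
      by simp
    then show "eventually (\<lambda>t. 0 \<le> d_omega N \<theta> t) at_top" by simp
    show "eventually (\<lambda>t. d_omega N \<theta> t \<le> (\<Sum>i\<in>?V. \<Sum>j\<in>?V. \<bar>dk.velocity i t - dk.velocity j t\<bar>)) at_top"
      using eventually_gt_at_top[of 0]
    proof eventually_elim
      case (elim t)
      show ?case
        unfolding d_omega_def
      proof (rule pair_Max_le[OF V])
        fix i j assume ij: "i \<in> ?V" "j \<in> ?V"
        have "\<bar>dk.velocity i t - dk.velocity j t\<bar> \<le> (\<Sum>j\<in>?V. \<bar>dk.velocity i t - dk.velocity j t\<bar>)"
          using ij by (intro member_le_sum) auto
        also have "\<dots> \<le> (\<Sum>i\<in>?V. \<Sum>j\<in>?V. \<bar>dk.velocity i t - dk.velocity j t\<bar>)"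
          using ij by (intro member_le_sum[where f = "\<lambda>i. \<Sum>j\<in>?V. \<bar>dk.velocity i t - dk.velocity j t\<bar>"] sum_nonneg) auto
        finally show "\<bar>omega \<theta> i t - omega \<theta> j t\<bar> \<le> (\<Sum>i\<in>?V. \<Sum>j\<in>?V. \<bar>dk.velocity i t - dk.velocity j t\<bar>)"
          using omega ij elim by simp
      qed
    qed
    have "((\<lambda>t. \<Sum>i\<in>?V. \<Sum>j\<in>?V. \<bar>dk.velocity i t - dk.velocity j t\<bar>) \<longlongrightarrow> (\<Sum>i\<in>?V. \<Sum>j\<in>?V. \<bar>0\<bar>)) at_top"
      by (intro tendsto_sum tendsto_rabs dk.frequencies_synchronise)
    then show "((\<lambda>t. \<Sum>i\<in>?V. \<Sum>j\<in>?V. \<bar>dk.velocity i t - dk.velocity j t\<bar>) \<longlongrightarrow> 0) at_top" by simp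
  qed simp
qed

end
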